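(* Let $A \in \mathbb{R}^{m \times n}$ and let $p \ge 1$ be an integer. For every integer $k \ge p$, let $\hat\theta_{2p}$ be the estimator of $\|A\|_{2p}^{2p}$ built from a Gaussian sketch of $A$ with sketch size $k$ (defined in the context). Then, as $k\to\infty$ with $A$ and $p$ fixed, $$\mathrm{Var}(\hat\theta_{2p}) \le \frac{2p^2\|A\|_{4p}^{4p}}{k} + \frac{p^2 (p-1)^2}{k^2} \left(\|A\|_{4p}^{4p} + \frac{3}{2} \|A\|_4^4\|A\|_{4p-4}^{4p-4} - \frac{1}{2}\|A\|_{2p}^{4p} \right) + \mathcal{O} \left( \frac{1}{k^3} \right),$$ where the constant in $\mathcal{O}(\cdot)$ depends on $p$ and is a symmetric function of the singular values of $A$ (and does not depend on $k$).
   Context: For a real matrix $A$ with singular values $\sigma_1,\dots,\sigma_{\min\{m,n\}}$ and an integer $q\ge 1$, the Schatten-$q$ norm is $\|A\|_q = \left(\sum_i \sigma_i^q\right)^{1/q}$. For $p=1$ the second term on the right-hand side is zero because of the factor $(p-1)^2$. Estimator: let $\Omega \in \mathbb{R}^{n\times k}$ be a random matrix with i.i.d. standard Gaussian $N(0,1)$ entries, $Y = A\Omega$, $Z = Y^TY \in \mathbb{R}^{k\times k}$, and let $T$ be the strictly upper triangular part of $Z$ (entries on and below the diagonal set to zero). Then $$\hat\theta_{2p} = \binom{k}{p}^{-1}\mathrm{trace}(T^{p-1}Z),$$ with $T^0 = I$. Equivalently, $\hat\theta_{2p} = \binom{k}{p}^{-1}\sum_{1\le i_1<\cdots<i_p\le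 k} Z_{i_1 i_2}Z_{i_2i_3}\cdots Z_{i_{p-1}i_p}Z_{i_pi_1}$. The variance is over the randomness of $\Omega$. *)

theory Defs
  imports "HOL-Probability.Probability" "Jordan_Normal_Form.Char_Poly"
begin

text \<open>
  The singular values of an \<open>m \<times> n\<close> matrix, as a multiset with \<open>min m n\<close> elements: the square
  roots of the eigenvalues, with multiplicity, of the smaller of its two Gram matrices.
\<close>

definition singular_values :: "real mat \<Rightarrow> real multiset" where
  "singular_values A =
     image_mset sqrt
       (proots (char_poly (if dim_col A \<le> dim_row A then A\<^sup>T * A else A * A\<^sup>T)))"

text \<open>Meaningful for \<open>q \<ge> 1\<close>; the value at \<open>q = 0\<close> is \<open>root 0 _ = 0\<close>.\<close>

definition schatten_norm :: "nat \<Rightarrow> real mat \<Rightarrow> real" where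
  "schatten_norm q A = root q (\<Sum>\<sigma>\<in>#singular_values A. \<sigma> ^ q)"

definition mat_trace :: "real mat \<Rightarrow> real" where
  "mat_trace A = (\<Sum>i<dim_row A. A $$ (i, i))"

definition strict_upper_part :: "real mat \<Rightarrow> real mat" where
  "strict_upper_part Z =
     mat (dim_row Z) (dim_col Z) (\<lambda>(i, j). if i < j then Z $$ (i, j) else 0)"

definition sketch_gram :: "real mat \<Rightarrow> real mat \<Rightarrow> real mat" where
  "sketch_gram A \<Omega> = (A * \<Omega>)\<^sup>T * (A * \<Omega>)"

text \<open>The estimator of \<open>schatten_norm (2 * p) A ^ (2 * p)\<close>; the sketch size is \<open>dim_col \<Omega>\<close>.\<close>

definition schatten_estimator :: "nat \<Rightarrow> real mat \<Rightarrow> real mat \<Rightarrow> real" where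
  "schatten_estimator p A \<Omega> =
     mat_trace (strict_upper_part (sketch_gram A \<Omega>) ^\<^sub>m (p - 1) * sketch_gram A \<Omega>)
       / real (dim_col \<Omega> choose p)"

text \<open>
  The joint law of the entries of an \<open>n \<times> k\<close> matrix with i.i.d. \<open>N(0,1)\<close> entries. An outcome
  is a family of entries \<open>\<omega>\<close>; the corresponding matrix is \<open>mat n k \<omega>\<close>.
\<close>

definition gaussian_entries :: "nat \<Rightarrow> nat \<Rightarrow> (nat \<times> nat \<Rightarrow> real) measure" where
  "gaussian_entries n k =
     (\<Pi>\<^sub>M ij \<in> {..<n} \<times> {..<k}. density lborel (\<lambda>x. ennreal (std_normal_density x)))"

definition estimator_variance :: "nat \<Rightarrow> real mat \<Rightarrow> nat \<Rightarrow> real" where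
  "estimator_variance p A k =
     prob_space.variance (gaussian_entries (dim_col A) k)
       (\<lambda>\<omega>. schatten_estimator p A (mat (dim_col A) k \<omega>))"

end

theory Submission
  imports Defs "Jordan_Normal_Form.Schur_Decomposition"
begin

text \<open>
  The estimator is the average, over the \<open>p\<close>-subsets \<open>I\<close> of the \<open>k\<close> columns, of the cyclic product
  \<open>X\<^sub>I = trace (\<Prod>\<^sub>c M \<omega>\<^sub>c \<omega>\<^sub>c\<^sup>T)\<close> with \<open>M = A\<^sup>T A\<close>, so its variance is the average of \<open>Cov (X\<^sub>I, X\<^sub>J)\<close>.
  Integrating out the columns outside \<open>I \<inter> J\<close> and applying Wick's formula to the others shows, with
  \<open>t\<^sub>q = trace (M\<^sup>q)\<close>, that the covariance is \<open>0\<close> if \<open>|I \<inter> J| = 0\<close>, is \<open>2 t\<^sub>2\<^sub>p\<close> if \<open>|I \<inter> J| = 1\<close>, and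
  is \<open>6 t\<^sub>2\<^sub>p + t\<^sub>e t\<^sub>f + t\<^sub>g t\<^sub>h\<close> with \<open>e + f = g + h = 2p\<close> and all indices at least \<open>2\<close> if \<open>|I \<inter> J| = 2\<close>; the
  products are at most \<open>t\<^sub>2 t\<^sub>2\<^sub>p\<^sub>-\<^sub>2\<close>. Every covariance is at most \<open>(t\<^sub>1\<^sup>2 + 2 t\<^sub>2)\<^sup>p\<close>, by Cauchy-Schwarz for the
  Gram matrix. As a function of \<open>s = |I \<inter> J|\<close> these bounds are dominated by a nonnegative
  combination of the binomials \<open>(s choose r)\<close>, \<open>r = 1, 2, 3\<close>, whose averages are \<open>(p choose r)\<^sup>2 / (k choose r)\<close>.
  Finally \<open>t\<^sub>p\<^sup>2 \<le> t\<^sub>2 t\<^sub>2\<^sub>p\<^sub>-\<^sub>2\<close> gives the stated second-order term.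
\<close>

section \<open>Power sums of singular values\<close>

lemma mat_trace_comm:
  assumes "A \<in> carrier_mat n m" "B \<in> carrier_mat m n"
  shows "mat_trace (A * B) = mat_trace (B * A)"
proof -
  have "mat_trace (A * B) = (\<Sum>i<n. \<Sum>j<m. A $$ (i, j) * B $$ (j, i))"
    using assms by (auto simp: mat_trace_def scalar_prod_def lessThan_atLeast0)
  also have "\<dots> = (\<Sum>j<m. \<Sum>i<n. B $$ (j, i) * A $$ (i, j))"
    by (subst sum.swap) (simp add: mult.commute)
  also have "\<dots> = mat_trace (B * A)"
    using assms by (auto simp: mat_trace_def scalar_prod_def lessThan_atLeast0)
  finally show ?thesis .
qed

text \<open>For an eigenvector \<open>v\<close> of \<open>B\<^sup>T * B\<close>, pairing the
  eigenvalue equation with the conjugate of \<open>v\<close> gives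
  \<open>l * |v|^2 = |B v|^2\<close>. Working over the complex numbers yields reality and sign of
  the eigenvalue at once.\<close>

lemma eigenvalue_gram_nonneg:
  fixes B :: "real mat" and l :: complex
  assumes B: "B \<in> carrier_mat m n"
    and ev: "eigenvalue (map_mat complex_of_real (B\<^sup>T * B)) l"
  shows "\<exists>r\<ge>0. l = complex_of_real r"
proof -
  define C where "C = map_mat complex_of_real B"
  have C: "C \<in> carrier_mat m n" using B by (simp add: C_def)
  have CC: "map_mat complex_of_real (B\<^sup>T * B) = C\<^sup>T * C"
    using B by (auto simp: C_def of_real_hom.mat_hom_mult[of "B\<^sup>T" n m B n] map_mat_transpose)
  from ev obtain v where v: "v \<in> carrier_vec n" "v \<noteq> 0\<^sub>v n" "(C\<^sup>T * C) *\<^sub>v v = l \<cdot>\<^sub>v v"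
    using C unfolding eigenvalue_def eigenvector_def CC by auto
  define u where "u = C *\<^sub>v v"
  have u: "u \<in> carrier_vec m" using C v by (simp add: u_def)
  have Cu: "C\<^sup>T *\<^sub>v u = l \<cdot>\<^sub>v v"
    using v C unfolding u_def by (metis assoc_mult_mat_vec transpose_carrier_mat)
  \<comment> \<open>The entries of \<open>C\<close> are real, so its transpose is also its
    adjoint.\<close>
  have cB: "cnj (C $$ (r, i)) = C $$ (r, i)" if "r < m" "i < n" for r i
    using that B by (simp add: C_def)
  have "(\<Sum>i<n. vec_index (l \<cdot>\<^sub>v v) i * cnj (vec_index v i)) = (\<Sum>i<n. (\<Sum>r<m. C $$ (r, i) * vec_index u r) * cnj (vec_index v i))"
    using C u v(1) by (simp flip: Cu add: scalar_prod_def lessThan_atLeast0)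
  also have "\<dots> = (\<Sum>r<m. vec_index u r * cnj (\<Sum>i<n. C $$ (r, i) * vec_index v i))"
    by (simp add: sum_distrib_left sum_distrib_right cB mult_ac cong: sum.cong) (subst sum.swap, simp add: mult_ac cB)
  also have "\<dots> = (\<Sum>r<m. vec_index u r * cnj (vec_index u r))"
    using C v(1) by (intro sum.cong refl) (simp add: u_def scalar_prod_def lessThan_atLeast0)
  also have "(\<Sum>i<n. vec_index (l \<cdot>\<^sub>v v) i * cnj (vec_index v i)) = l * (\<Sum>i<n. vec_index v i * cnj (vec_index v i))"
    using v(1) by (simp add: sum_distrib_left mult.assoc)
  finally have eq: "l * complex_of_real (\<Sum>i<n. (cmod (vec_index v i))\<^sup>2) = complex_of_real (\<Sum>r<m. (cmod (vec_index u r))\<^sup>2)"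
    by (simp add: complex_norm_square del: of_real_power)
  obtain i where i: "i < n" "vec_index v i \<noteq> 0"
    using v(1,2) by (metis carrier_vecD eq_vecI index_zero_vec(1) index_zero_vec(2))
  have pos: "(\<Sum>i<n. (cmod (vec_index v i))\<^sup>2) > 0"
    by (rule sum_pos2[where i = i]) (use i in auto)
  then have "l = complex_of_real ((\<Sum>r<m. (cmod (vec_index u r))\<^sup>2) / (\<Sum>i<n. (cmod (vec_index v i))\<^sup>2))"
    using eq by (simp add: field_simps del: of_real_sum)
  moreover have "(\<Sum>r<m. (cmod (vec_index u r))\<^sup>2) / (\<Sum>i<n. (cmod (vec_index v i))\<^sup>2) \<ge> 0"
    by (intro divide_nonneg_nonneg sum_nonneg) auto
  ultimately show ?thesis by blast
qed

text \<open>Over the complex numbers the polynomial splits; its roots are eigenvalues, hence real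
  and nonnegative, and injectivity of the embedding on polynomials brings the factorization back to
  the reals.\<close>

lemma char_poly_gram:
  fixes B :: "real mat"
  assumes B: "B \<in> carrier_mat m n"
  shows "\<exists>es. char_poly (B\<^sup>T * B) = (\<Prod>e\<leftarrow>es. [:- e, 1:]) \<and> (\<forall>e\<in>set es. e \<ge> 0)"
proof -
  define G where "G = B\<^sup>T * B"
  have G: "G \<in> carrier_mat n n" using B by (simp add: G_def)
  then have Gc: "map_mat complex_of_real G \<in> carrier_mat n n" by simp
  obtain as where as: "char_poly (map_mat complex_of_real G) = (\<Prod>a\<leftarrow>as. [:- a, 1:])"
    using char_poly_factorized[OF Gc] by blast
  have real: "\<exists>r\<ge>0. a = complex_of_real r" if "a \<in> set as" for a
  proof (rule eigenvalue_gram_nonneg[OF B])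
    show "eigenvalue (map_mat complex_of_real (B\<^sup>T * B)) a"
      using eigenvalue_root_char_poly[OF Gc, of a] that
      unfolding as G_def[symmetric] by (auto simp: poly_prod_list prod_list_zero_iff image_iff)
  qed
  define es where "es = map Re as"
  have es: "as = map complex_of_real es"
    unfolding es_def map_map o_def
    by (subst map_idI) (use real in fastforce)+
  interpret h: map_poly_inj_comm_ring_hom complex_of_real ..
  have "map_poly complex_of_real (char_poly G) = map_poly complex_of_real (\<Prod>e\<leftarrow>es. [:- e, 1:])"
    by (simp add: of_real_hom.char_poly_hom[OF G, symmetric] as es h.hom_prod_list o_def
        of_real_hom.map_poly_pCons_hom)
  then have "char_poly G = (\<Prod>e\<leftarrow>es. [:- e, 1:])" by (rule h.injectivity)
  moreover have "\<forall>e\<in>set es. e \<ge> 0" using real by (force simp: es_def)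
  ultimately show ?thesis unfolding G_def by blast
qed

section \<open>Traces of powers via triangularization\<close>

lemma upper_triangular_mult:
  fixes P Q :: "real mat"
  assumes "P \<in> carrier_mat n n" "Q \<in> carrier_mat n n" "upper_triangular P" "upper_triangular Q"
  shows "upper_triangular (P * Q)"
    and "\<And>i. i < n \<Longrightarrow> (P * Q) $$ (i, i) = P $$ (i, i) * Q $$ (i, i)"
proof -
  have z: "P $$ (i, r) * Q $$ (r, j) = 0" if "i < n" "r < n" "j < n" "r < i \<or> j < r" for i r j
    using that assms unfolding upper_triangular_def by auto
  show "upper_triangular (P * Q)"
  proof (rule upper_triangularI)
    fix i j assume ij: "j < i" "i < dim_row (P * Q)"
    then have "(P * Q) $$ (i, j) = (\<Sum>r = 0..<n. P $$ (i, r) * Q $$ (r, j))"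
      using assms by (auto simp: scalar_prod_def)
    also have "\<dots> = 0"
    proof (intro sum.neutral ballI)
      fix r assume "r \<in> {0..<n}"
      moreover have "r < i \<or> j < r" using ij by linarith
      ultimately show "P $$ (i, r) * Q $$ (r, j) = 0" using ij assms z[of i r j] by auto
    qed
    finally show "(P * Q) $$ (i, j) = 0" .
  qed
  fix i assume i: "i < n"
  then have "(P * Q) $$ (i, i) = (\<Sum>r = 0..<n. P $$ (i, r) * Q $$ (r, i))"
    using assms by (auto simp: scalar_prod_def)
  also have "\<dots> = (\<Sum>r\<in>{i}. P $$ (i, r) * Q $$ (r, i))"
    using i by (intro sum.mono_neutral_right ballI z) auto
  finally show "(P * Q) $$ (i, i) = P $$ (i, i) * Q $$ (i, i)" by simp
qed

lemma upper_triangular_pow: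
  fixes P :: "real mat"
  assumes "P \<in> carrier_mat n n" "upper_triangular P"
  shows "upper_triangular (P ^\<^sub>m q) \<and> (\<forall>i<n. (P ^\<^sub>m q) $$ (i, i) = (P $$ (i, i)) ^ q)"
proof (induction q)
  case 0
  then show ?case using assms by auto
next
  case (Suc q)
  then show ?case
    using upper_triangular_mult[of "P ^\<^sub>m q" n P] assms by (auto simp: mult.commute)
qed

text \<open>Schur decomposition writes \<open>G = Q * P * R\<close> with \<open>R\<close> inverse to
  \<open>Q\<close> and \<open>P\<close> upper triangular with diagonal \<open>es\<close>. Then
  \<open>G ^\<^sub>m q\<close> is conjugate to a triangular matrix whose diagonal holds the powers
  \<open>e ^ q\<close>.\<close>

lemma mat_trace_pow_char_poly:
  fixes G :: "real mat"
  assumes G: "G \<in> carrier_mat n n" and es: "char_poly G = (\<Prod>e\<leftarrow>es. [:- e, 1:])"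
  shows "mat_trace (G ^\<^sub>m q) = (\<Sum>e\<leftarrow>es. e ^ q)"
proof -
  obtain P Q R where "schur_decomposition G es = (P, Q, R)" by (metis prod_cases3)
  from schur_decomposition[OF G es this]
  have w: "similar_mat_wit G P Q R" and ut: "upper_triangular P" and d: "diag_mat P = es" by auto
  from similar_mat_witD2[OF G w]
  have c: "P \<in> carrier_mat n n" "Q \<in> carrier_mat n n" "R \<in> carrier_mat n n" and RQ: "R * Q = 1\<^sub>m n" by auto
  have "mat_trace (G ^\<^sub>m q) = mat_trace ((Q * P ^\<^sub>m q) * R)"
    using similar_mat_wit_pow_id[OF w] by simp
  also have "\<dots> = mat_trace (R * (Q * P ^\<^sub>m q))"
    using c by (intro mat_trace_comm[where n = n and m = n]) auto
  also have "R * (Q * P ^\<^sub>m q) = P ^\<^sub>m q"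
    using c RQ by (subst assoc_mult_mat[symmetric, where ?n\<^sub>1 = n]) auto
  also have "mat_trace (P ^\<^sub>m q) = (\<Sum>i<n. (P $$ (i, i)) ^ q)"
    using upper_triangular_pow[OF c(1) ut] c by (simp add: mat_trace_def)
  also have "\<dots> = (\<Sum>e\<leftarrow>es. e ^ q)"
    using c by (simp add: d[symmetric] diag_mat_def o_def interv_sum_list_conv_sum_set_nat lessThan_atLeast0)
  finally show ?thesis .
qed

lemma pow_mat_Suc_left:
  assumes "G \<in> carrier_mat n n"
  shows "G ^\<^sub>m Suc q = G * G ^\<^sub>m q"
proof (induction q)
  case 0
  then show ?case using assms by simp
next
  case (Suc q)
  have "G ^\<^sub>m Suc (Suc q) = (G * G ^\<^sub>m q) * G" using Suc by simp
  also have "\<dots> = G * (G ^\<^sub>m q * G)" using assms by (intro assoc_mult_mat) auto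
  finally show ?case by simp
qed

text \<open>The intertwining \<open>(A * A\<^sup>T) ^\<^sub>m q * A = A * (A\<^sup>T * A) ^\<^sub>m
  q\<close> and one cyclic rotation of the trace. The exponent is a successor because at exponent 0
  the two traces are \<open>m\<close> and \<open>n\<close>.\<close>

lemma mat_trace_gram_swap:
  fixes A :: "real mat"
  assumes A: "A \<in> carrier_mat m n"
  shows "mat_trace ((A * A\<^sup>T) ^\<^sub>m Suc q) = mat_trace ((A\<^sup>T * A) ^\<^sub>m Suc q)"
proof -
  have *: "(A * A\<^sup>T) ^\<^sub>m q * A = A * (A\<^sup>T * A) ^\<^sub>m q" for q
  proof (induction q)
    case 0
    then show ?case using A by simp
  next
    case (Suc q)
    have "(A * A\<^sup>T) ^\<^sub>m Suc q * A = (A * A\<^sup>T) ^\<^sub>m q * (A * A\<^sup>T * A)"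
      unfolding pow_mat.simps using A
      by (intro assoc_mult_mat[where ?n\<^sub>1 = m and ?n\<^sub>2 = m and ?n\<^sub>3 = m and ?n\<^sub>4 = n]) (auto intro!: pow_carrier_mat)
    also have "A * A\<^sup>T * A = A * (A\<^sup>T * A)"
      using A by (intro assoc_mult_mat) auto
    also have "(A * A\<^sup>T) ^\<^sub>m q * (A * (A\<^sup>T * A)) = (A * A\<^sup>T) ^\<^sub>m q * A * (A\<^sup>T * A)"
      using A by (intro assoc_mult_mat[symmetric, where ?n\<^sub>1 = m and ?n\<^sub>2 = m and ?n\<^sub>3 = n and ?n\<^sub>4 = n]) (auto intro!: pow_carrier_mat)
    also have "\<dots> = A * (A\<^sup>T * A) ^\<^sub>m q * (A\<^sup>T * A)" by (simp only: Suc)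
    also have "\<dots> = A * (A\<^sup>T * A) ^\<^sub>m Suc q"
      unfolding pow_mat.simps using A
      by (intro assoc_mult_mat[where ?n\<^sub>1 = m and ?n\<^sub>2 = n and ?n\<^sub>3 = n and ?n\<^sub>4 = n]) (auto intro!: pow_carrier_mat)
    finally show ?case .
  qed
  have "(A * A\<^sup>T) ^\<^sub>m Suc q = (A * A\<^sup>T) ^\<^sub>m q * A * A\<^sup>T"
    unfolding pow_mat.simps using A
    by (intro assoc_mult_mat[symmetric, where ?n\<^sub>1 = m and ?n\<^sub>2 = m and ?n\<^sub>3 = n and ?n\<^sub>4 = m]) (auto intro!: pow_carrier_mat)
  also have "\<dots> = (A * (A\<^sup>T * A) ^\<^sub>m q) * A\<^sup>T" by (simp only: *)
  finally have "mat_trace ((A * A\<^sup>T) ^\<^sub>m Suc q) = mat_trace ((A * (A\<^sup>T * A) ^\<^sub>m q) * A\<^sup>T)" by simp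
  also have "\<dots> = mat_trace (A\<^sup>T * (A * (A\<^sup>T * A) ^\<^sub>m q))"
    using A by (intro mat_trace_comm[where n = m and m = n]) (auto intro!: mult_carrier_mat pow_carrier_mat)
  also have "A\<^sup>T * (A * (A\<^sup>T * A) ^\<^sub>m q) = (A\<^sup>T * A) * (A\<^sup>T * A) ^\<^sub>m q"
    using A by (intro assoc_mult_mat[symmetric, where ?n\<^sub>1 = n and ?n\<^sub>2 = m and ?n\<^sub>3 = n and ?n\<^sub>4 = n]) (auto intro!: pow_carrier_mat)
  also have "\<dots> = (A\<^sup>T * A) ^\<^sub>m Suc q"
    using A by (intro pow_mat_Suc_left[symmetric]) auto
  finally show ?thesis .
qed

text \<open>The exponent is doubled so that this is the \<open>q\<close>-th power sum of the
  eigenvalues of the Gram matrix. Being a function of the multiset alone, it is symmetric in the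
  singular values.\<close>

definition power_sum :: "nat \<Rightarrow> real multiset \<Rightarrow> real" where
  "power_sum q S = (\<Sum>\<sigma>\<in>#S. \<sigma> ^ (2 * q))"

lemma proots_linear_factors: "proots (\<Prod>e\<leftarrow>es. [:- e, 1:]) = mset (es :: real list)"
proof (induction es)
  case (Cons e es)
  have "(\<Prod>e\<leftarrow>es. [:- e, 1:]) \<noteq> 0" by (auto simp: prod_list_zero_iff)
  then show ?case using Cons by (simp add: proots_mult del: mult_pCons_left)
qed simp

text \<open>The singular values are read off the smaller Gram matrix, whereas the Gaussian
  computation uses \<open>A\<^sup>T * A\<close>. The two differ in zero eigenvalues only, which are
  invisible for \<open>q \<ge> 1\<close>; at \<open>q = 0\<close> the two sides would be
  \<open>min m n\<close> and \<open>n\<close>.\<close>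

lemma power_sum_singular_values:
  assumes A: "A \<in> carrier_mat m n" and q: "q \<ge> 1"
  shows "power_sum q (singular_values A) = mat_trace ((A\<^sup>T * A) ^\<^sub>m q)"
proof -
  \<comment> \<open>\<open>B\<close> has \<open>min m n\<close> columns, so
    \<open>B\<^sup>T * B\<close> is the smaller Gram matrix in both cases.\<close>
  define B where "B = (if n \<le> m then A else A\<^sup>T)"
  define r where "r = min m n"
  have B: "B \<in> carrier_mat (max m n) r" using A by (auto simp: B_def r_def max_def min_def)
  have G: "B\<^sup>T * B = (if dim_col A \<le> dim_row A then A\<^sup>T * A else A * A\<^sup>T)"
    using A by (auto simp: B_def)
  from char_poly_gram[OF B] obtain es where
    es: "char_poly (B\<^sup>T * B) = (\<Prod>e\<leftarrow>es. [:- e, 1:])" "\<forall>e\<in>set es. e \<ge> 0" by blast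
  have "singular_values A = image_mset sqrt (mset es)"
    unfolding singular_values_def G[symmetric] es(1) proots_linear_factors ..
  then have "power_sum q (singular_values A) = (\<Sum>e\<in>#mset es. sqrt e ^ (2 * q))"
    by (simp add: power_sum_def image_mset.compositionality o_def)
  also have "\<dots> = (\<Sum>e\<in>#mset es. e ^ q)"
    using es(2) by (intro arg_cong[where f = sum_mset] image_mset_cong) (simp add: power_mult)
  also have "\<dots> = (\<Sum>e\<leftarrow>es. e ^ q)" by (metis mset_map sum_mset_sum_list)
  also have "\<dots> = mat_trace ((B\<^sup>T * B) ^\<^sub>m q)"
    using B by (intro mat_trace_pow_char_poly[OF _ es(1), symmetric]) auto
  also have "\<dots> = mat_trace ((A\<^sup>T * A) ^\<^sub>m q)"
    using mat_trace_gram_swap[OF A, of "q - 1"] q A unfolding G by simp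
  finally show ?thesis .
qed

lemma power_sum_nonneg: "power_sum q S \<ge> 0"
  unfolding power_sum_def by (induction S) (auto simp: power_mult)

lemma schatten_norm_pow:
  assumes "q \<ge> 1"
  shows "schatten_norm (2 * q) A ^ (2 * q) = power_sum q (singular_values A)"
  using assms power_sum_nonneg[of q "singular_values A"]
  unfolding schatten_norm_def power_sum_def by (intro real_root_pow_pos2) auto

text \<open>Pairs \<open>\<sigma>, \<tau>\<close> and \<open>\<tau>, \<sigma>\<close> are taken together: with \<open>x = \<sigma>\<^sup>2\<close> and \<open>y = \<tau>\<^sup>2\<close>,
  the difference of the two sides is \<open>x\<^sup>2 y\<^sup>2 (x^(e-2) - y^(e-2)) (x^(f-2) - y^(f-2))\<close>.\<close>
lemma power_sum_mult_le:
  assumes "e \<ge> 2" "f \<ge> 2"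
  shows "power_sum e S * power_sum f S \<le> power_sum 2 S * power_sum (e + f - 2) S"
proof -
  obtain a b where e: "e = a + 2" and f: "f = b + 2" using assms by (metis add.commute le_Suc_ex)
  have pt: "x ^ e * y ^ f + y ^ e * x ^ f \<le> x ^ 2 * y ^ (e + f - 2) + y ^ 2 * x ^ (e + f - 2)"
    if "x \<ge> 0" "y \<ge> 0" for x y :: real
  proof -
    \<comment> \<open>Powers are monotone on nonnegative reals, so the two factors never have
      opposite signs.\<close>
    have "(x ^ a - y ^ a) * (x ^ b - y ^ b) \<ge> 0"
    proof (cases "x \<le> y")
      case True
      then show ?thesis using that by (intro mult_nonpos_nonpos) (simp_all add: power_mono)
    next
      case False
      then show ?thesis using that by (intro mult_nonneg_nonneg) (simp_all add: power_mono)
    qed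
    then have "(x * y)\<^sup>2 * ((x ^ a - y ^ a) * (x ^ b - y ^ b)) \<ge> 0" by simp
    then show ?thesis by (simp add: e f power_add power2_eq_square algebra_simps)
  qed
  have prod: "power_sum i S * power_sum j S = (\<Sum>\<sigma>\<in>#S. \<Sum>\<tau>\<in>#S. (\<sigma>\<^sup>2) ^ i * (\<tau>\<^sup>2) ^ j)" for i j
    unfolding power_sum_def power_mult sum_mset_product ..
  have swap: "power_sum i S * power_sum j S = (\<Sum>\<sigma>\<in>#S. \<Sum>\<tau>\<in>#S. (\<tau>\<^sup>2) ^ i * (\<sigma>\<^sup>2) ^ j)" for i j
    using prod[of j i] by (simp add: mult.commute)
  have "2 * (power_sum e S * power_sum f S)
      = (\<Sum>\<sigma>\<in>#S. \<Sum>\<tau>\<in>#S. (\<sigma>\<^sup>2) ^ e * (\<tau>\<^sup>2) ^ f + (\<tau>\<^sup>2) ^ e * (\<sigma>\<^sup>2) ^ f)"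
    using prod[of e f] swap[of e f] by (simp add: sum_mset.distrib)
  also have "\<dots> \<le> (\<Sum>\<sigma>\<in>#S. \<Sum>\<tau>\<in>#S. (\<sigma>\<^sup>2) ^ 2 * (\<tau>\<^sup>2) ^ (e + f - 2) + (\<tau>\<^sup>2) ^ 2 * (\<sigma>\<^sup>2) ^ (e + f - 2))"
    by (intro sum_mset_mono pt) auto
  also have "\<dots> = 2 * (power_sum 2 S * power_sum (e + f - 2) S)"
    using prod[of 2 "e + f - 2"] swap[of 2 "e + f - 2"] by (simp add: sum_mset.distrib)
  finally show ?thesis by simp
qed

section \<open>The estimator as a sum over subsets, and hypergeometric averages\<close>

fun path_prod :: "(nat \<Rightarrow> nat \<Rightarrow> real) \<Rightarrow> nat list \<Rightarrow> real" where
  "path_prod Z (a # b # l) = Z a b * path_prod Z (b # l)"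
| "path_prod Z _ = 1"

text \<open>For a single vertex the path is empty and the closing factor is the diagonal entry
  \<open>Z a a\<close>, as the estimator with \<open>p = 1\<close> requires.\<close>

definition cycle_prod :: "(nat \<Rightarrow> nat \<Rightarrow> real) \<Rightarrow> nat list \<Rightarrow> real" where
  "cycle_prod Z l = path_prod Z l * Z (last l) (hd l)"

lemma path_prod_cong:
  assumes "\<And>i j. i \<in> set l \<Longrightarrow> j \<in> set l \<Longrightarrow> Y i j = Z i j"
  shows "path_prod Y l = path_prod Z l"
  using assms by (induction Y l rule: path_prod.induct) auto

lemma cycle_prod_cong:
  assumes "l \<noteq> []" "\<And>i j. i \<in> set l \<Longrightarrow> j \<in> set l \<Longrightarrow> Y i j = Z i j"
  shows "cycle_prod Y l = cycle_prod Z l"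
  using path_prod_cong[of l Y Z] assms by (simp add: cycle_prod_def)

definition subsets_of_card :: "nat \<Rightarrow> nat \<Rightarrow> nat set set" where
  "subsets_of_card k p = {I. I \<subseteq> {..<k} \<and> card I = p}"

lemma finite_subsets_of_card [simp]: "finite (subsets_of_card k p)"
  unfolding subsets_of_card_def by (rule finite_subset[of _ "Pow {..<k}"]) auto

lemma card_subsets_of_card: "card (subsets_of_card k p) = k choose p"
  unfolding subsets_of_card_def using n_subsets[of "{..<k}" p] by simp

lemma subset_list:
  assumes "I \<in> subsets_of_card k p"
  shows "set (sorted_list_of_set I) = I" "I \<subseteq> {..<k}" "length (sorted_list_of_set I) = p"
proof -
  have "finite I" using assms by (auto simp: subsets_of_card_def intro: finite_subset)
  then show "set (sorted_list_of_set I) = I" "I \<subseteq> {..<k}" "length (sorted_list_of_set I) = p"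
    using assms by (auto simp: subsets_of_card_def)
qed

lemma mat_mult_entry:
  fixes P Q :: "real mat"
  assumes "P \<in> carrier_mat n r" "Q \<in> carrier_mat r s" "a < n" "b < s"
  shows "(P * Q) $$ (a, b) = (\<Sum>d<r. P $$ (a, d) * Q $$ (d, b))"
  using assms by (simp add: scalar_prod_def lessThan_atLeast0)

section \<open>Walks of a strictly upper triangular matrix\<close>

context
  fixes k :: nat
begin

text \<open>The walks from \<open>i\<close> with \<open>q\<close> steps, hence \<open>q + 1\<close>
  vertices, along which a strictly upper triangular matrix can have nonzero entries.\<close>

private definition chains :: "nat \<Rightarrow> nat \<Rightarrow> nat list set" where
  "chains q i = {l. length l = Suc q \<and> hd l = i \<and> sorted_wrt (<) l \<and> set l \<subseteq> {..<k}}"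

private lemma finite_chains: "finite (chains q i)"
  by (rule finite_subset[OF _ finite_lists_length_eq[of "{..<k}" "Suc q"]]) (auto simp: chains_def)

private lemma chains_0: "i < k \<Longrightarrow> chains 0 i = {[i]}"
  by (auto simp: chains_def length_Suc_conv)

private lemma chains_Suc:
  assumes "i < k"
  shows "chains (Suc q) i = (\<Union>m\<in>{i<..<k}. (#) i ` chains q m)"
proof (intro equalityI subsetI)
  fix l assume "l \<in> chains (Suc q) i"
  then obtain b l' where l: "l = i # b # l'" "length l' = q" "sorted_wrt (<) l" "set l \<subseteq> {..<k}"
    by (auto simp: chains_def length_Suc_conv)
  then have "b # l' \<in> chains q b" "b \<in> {i<..<k}" by (auto simp: chains_def)
  with l show "l \<in> (\<Union>m\<in>{i<..<k}. (#) i ` chains q m)" by blast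
next
  fix l assume "l \<in> (\<Union>m\<in>{i<..<k}. (#) i ` chains q m)"
  then obtain m l' where m: "i < m" "m < k" "l = i # l'" "l' \<in> chains q m" by auto
  then obtain l'' where "l' = m # l''" by (cases l') (auto simp: chains_def)
  with m show "l \<in> chains (Suc q) i" by (auto simp: chains_def)
qed

private lemma sum_chains_Suc:
  assumes "i < k"
  shows "sum f (chains (Suc q) i) = (\<Sum>m\<in>{i<..<k}. \<Sum>l\<in>chains q m. f (i # l))"
proof -
  have "sum f (chains (Suc q) i) = (\<Sum>m\<in>{i<..<k}. sum f ((#) i ` chains q m))"
    unfolding chains_Suc[OF assms]
    by (intro sum.UNION_disjoint) (auto simp: finite_chains, auto simp: chains_def)
  then show ?thesis by (simp add: sum.reindex)
qed

text \<open>Expanding a matrix power gives a sum over walks, and strict triangularity keeps the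
  increasing ones. Summing against a weight \<open>v\<close> leaves the end point free, so that the
  factor closing the cycle can be inserted for \<open>v\<close> later; the induction peels off the
  first step.\<close>

private lemma strict_upper_pow:
  assumes Z: "Z \<in> carrier_mat k k" and i: "i < k"
  shows "(\<Sum>j<k. (strict_upper_part Z ^\<^sub>m q) $$ (i, j) * v j)
    = (\<Sum>l\<in>chains q i. path_prod (\<lambda>i j. Z $$ (i, j)) l * v (last l))"
  using i
proof (induction q arbitrary: i)
  case 0
  have "(\<Sum>j<k. (strict_upper_part Z ^\<^sub>m 0) $$ (i, j) * v j) = (\<Sum>j<k. if i = j then v j else 0)"
    using Z 0 by (intro sum.cong) (auto simp: strict_upper_part_def)
  then show ?case using 0 by (simp add: chains_0)
next
  case (Suc q)
  define T where "T = strict_upper_part Z"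
  have T: "T \<in> carrier_mat k k" using Z by (auto simp: T_def strict_upper_part_def)
  have "(\<Sum>j<k. (T ^\<^sub>m Suc q) $$ (i, j) * v j) = (\<Sum>j<k. \<Sum>m<k. T $$ (i, m) * ((T ^\<^sub>m q) $$ (m, j) * v j))"
    using T Suc.prems unfolding pow_mat_Suc_left[OF T]
    by (intro sum.cong refl) (simp add: mat_mult_entry[of _ k k _ k] sum_distrib_right mult.assoc del: index_mult_mat(1))
  also have "\<dots> = (\<Sum>m<k. T $$ (i, m) * (\<Sum>j<k. (T ^\<^sub>m q) $$ (m, j) * v j))"
    by (subst sum.swap) (simp add: sum_distrib_left)
  also have "\<dots> = (\<Sum>m\<in>{i<..<k}. Z $$ (i, m) * (\<Sum>j<k. (T ^\<^sub>m q) $$ (m, j) * v j))"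
    using Z Suc.prems by (intro sum.mono_neutral_cong_right) (auto simp: T_def strict_upper_part_def)
  also have "\<dots> = (\<Sum>m\<in>{i<..<k}. \<Sum>l\<in>chains q m. path_prod (\<lambda>i j. Z $$ (i, j)) (i # l) * v (last (i # l)))"
  proof (intro sum.cong refl)
    fix m assume m: "m \<in> {i<..<k}"
    have "Z $$ (i, m) * (\<Sum>j<k. (T ^\<^sub>m q) $$ (m, j) * v j)
        = (\<Sum>l\<in>chains q m. Z $$ (i, m) * (path_prod (\<lambda>i j. Z $$ (i, j)) l * v (last l)))"
      using m Suc.IH[of m] by (simp add: T_def sum_distrib_left)
    also have "\<dots> = (\<Sum>l\<in>chains q m. path_prod (\<lambda>i j. Z $$ (i, j)) (i # l) * v (last (i # l)))"
    proof (intro sum.cong refl)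
      fix l assume "l \<in> chains q m"
      then obtain l' where "l = m # l'" by (cases l) (auto simp: chains_def)
      then show "Z $$ (i, m) * (path_prod (\<lambda>i j. Z $$ (i, j)) l * v (last l))
          = path_prod (\<lambda>i j. Z $$ (i, j)) (i # l) * v (last (i # l))" by simp
    qed
    finally show "Z $$ (i, m) * (\<Sum>j<k. (T ^\<^sub>m q) $$ (m, j) * v j)
        = (\<Sum>l\<in>chains q m. path_prod (\<lambda>i j. Z $$ (i, j)) (i # l) * v (last (i # l)))" .
  qed
  finally show ?case using Suc.prems by (simp add: sum_chains_Suc T_def)
qed

text \<open>Closing each increasing walk with \<open>p\<close> vertices by an entry of
  \<open>Z\<close> turns the trace into a sum of cyclic products; such walks correspond to
  \<open>p\<close>-subsets through \<open>set\<close> and \<open>sorted_list_of_set\<close>.\<close>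

lemma trace_strict_upper_pow:
  assumes Z: "Z \<in> carrier_mat k k" and p: "p \<ge> 1"
  shows "mat_trace (strict_upper_part Z ^\<^sub>m (p - 1) * Z)
    = (\<Sum>I\<in>subsets_of_card k p. cycle_prod (\<lambda>i j. Z $$ (i, j)) (sorted_list_of_set I))"
proof -
  define T where "T = strict_upper_part Z ^\<^sub>m (p - 1)"
  have T: "T \<in> carrier_mat k k" using Z by (auto simp: T_def strict_upper_part_def intro!: pow_carrier_mat)
  have "mat_trace (T * Z) = (\<Sum>i<k. \<Sum>j<k. T $$ (i, j) * Z $$ (j, i))"
    using T Z by (simp add: mat_trace_def mat_mult_entry[of _ k k _ k] del: index_mult_mat(1))
  also have "\<dots> = (\<Sum>i<k. \<Sum>l\<in>chains (p - 1) i. path_prod (\<lambda>i j. Z $$ (i, j)) l * Z $$ (last l, i))"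
    using Z unfolding T_def by (intro sum.cong refl strict_upper_pow) auto
  also have "\<dots> = (\<Sum>i<k. \<Sum>l\<in>chains (p - 1) i. cycle_prod (\<lambda>i j. Z $$ (i, j)) l)"
    by (intro sum.cong refl) (auto simp: cycle_prod_def chains_def)
  also have "\<dots> = (\<Sum>l\<in>(\<Union>i<k. chains (p - 1) i). cycle_prod (\<lambda>i j. Z $$ (i, j)) l)"
    by (intro sum.UNION_disjoint[symmetric]) (auto simp: finite_chains, auto simp: chains_def)
  also have "\<dots> = (\<Sum>I\<in>subsets_of_card k p. cycle_prod (\<lambda>i j. Z $$ (i, j)) (sorted_list_of_set I))"
  proof (rule sum.reindex_bij_witness[where i = sorted_list_of_set and j = set])
    fix l assume "l \<in> (\<Union>i<k. chains (p - 1) i)"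
    then have l: "sorted_wrt (<) l" "length l = p" "set l \<subseteq> {..<k}"
      using p by (auto simp: chains_def)
    then show sl: "sorted_list_of_set (set l) = l"
      by (simp add: strict_sorted_iff sorted_list_of_set.idem_if_sorted_distinct)
    show "set l \<in> subsets_of_card k p"
      using l by (auto simp: subsets_of_card_def strict_sorted_iff distinct_card)
    show "cycle_prod (\<lambda>i j. Z $$ (i, j)) (sorted_list_of_set (set l)) = cycle_prod (\<lambda>i j. Z $$ (i, j)) l"
      by (simp add: sl)
  next
    fix I assume "I \<in> subsets_of_card k p"
    then have I: "I \<subseteq> {..<k}" "card I = p" "finite I"
      by (auto simp: subsets_of_card_def intro: finite_subset)
    then show "set (sorted_list_of_set I) = I" by simp
    have "sorted_list_of_set I \<noteq> []" using I p by auto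
    then have "hd (sorted_list_of_set I) < k" using I by (metis hd_in_set lessThan_iff set_sorted_list_of_set subsetD)
    moreover have "sorted_list_of_set I \<in> chains (p - 1) (hd (sorted_list_of_set I))"
      using I p by (auto simp: chains_def)
    ultimately show "sorted_list_of_set I \<in> (\<Union>i<k. chains (p - 1) i)" by blast
  qed
  finally show ?thesis unfolding T_def .
qed

end

section \<open>Averages over pairs of subsets\<close>

lemma card_supersets_of_card:
  assumes R: "R \<in> subsets_of_card k r" and "r \<le> p"
  shows "card {I \<in> subsets_of_card k p. R \<subseteq> I} = (k - r) choose (p - r)"
proof -
  have finR: "finite R" and cR: "card R = r" "R \<subseteq> {..<k}"
    using R by (auto simp: subsets_of_card_def intro: finite_subset)
  have "bij_betw (\<lambda>I. I - R) {I \<in> subsets_of_card k p. R \<subseteq> I} {S. S \<subseteq> {..<k} - R \<and> card S = p - r}"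
  proof (rule bij_betwI[where g = "\<lambda>S. S \<union> R"])
    show "(\<lambda>I. I - R) \<in> {I \<in> subsets_of_card k p. R \<subseteq> I} \<rightarrow> {S. S \<subseteq> {..<k} - R \<and> card S = p - r}"
      using finR cR by (auto simp: subsets_of_card_def card_Diff_subset)
    show "(\<lambda>S. S \<union> R) \<in> {S. S \<subseteq> {..<k} - R \<and> card S = p - r} \<rightarrow> {I \<in> subsets_of_card k p. R \<subseteq> I}"
    proof
      fix S assume S: "S \<in> {S. S \<subseteq> {..<k} - R \<and> card S = p - r}"
      then have "finite S" by (auto intro: finite_subset[of _ "{..<k}"])
      with S have "card (S \<union> R) = p"
        using finR cR \<open>r \<le> p\<close> by (subst card_Un_disjoint) auto
      with S cR show "S \<union> R \<in> {I \<in> subsets_of_card k p. R \<subseteq> I}"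
        by (auto simp: subsets_of_card_def)
    qed
  qed auto
  then have "card {I \<in> subsets_of_card k p. R \<subseteq> I} = card {S. S \<subseteq> {..<k} - R \<and> card S = p - r}"
    by (rule bij_betw_same_card)
  also have "\<dots> = (k - r) choose (p - r)"
    using finR cR by (subst n_subsets) (auto simp: card_Diff_subset)
  finally show ?thesis .
qed

text \<open>Double counting of the \<open>r\<close>-subsets of \<open>I \<inter> J\<close>: the factorial moments of the
  hypergeometric distribution.\<close>
lemma sum_card_inter_choose:
  assumes "r \<le> p" "p \<le> k"
  shows "(\<Sum>I\<in>subsets_of_card k p. \<Sum>J\<in>subsets_of_card k p. real (card (I \<inter> J) choose r))
    = (real (k choose p))\<^sup>2 * (real (p choose r))\<^sup>2 / real (k choose r)"
proof -
  let ?P = "subsets_of_card k p" and ?R = "subsets_of_card k r"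
  have count: "real (card (I \<inter> J) choose r) = (\<Sum>R\<in>?R. of_bool (R \<subseteq> I) * of_bool (R \<subseteq> J))"
    if "I \<in> ?P" "J \<in> ?P" for I J
  proof -
    have "finite I" using that by (auto simp: subsets_of_card_def intro: finite_subset)
    then have "card (I \<inter> J) choose r = card {R. R \<subseteq> I \<inter> J \<and> card R = r}"
      by (subst n_subsets) auto
    also have "{R. R \<subseteq> I \<inter> J \<and> card R = r} = {R \<in> ?R. R \<subseteq> I \<and> R \<subseteq> J}"
      using that by (auto simp: subsets_of_card_def)
    finally have "real (card (I \<inter> J) choose r) = (\<Sum>R\<in>{R \<in> ?R. R \<subseteq> I \<and> R \<subseteq> J}. 1)" by simp
    also have "\<dots> = (\<Sum>R\<in>?R. if R \<subseteq> I \<and> R \<subseteq> J then 1 else 0)"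
      by (rule sum.inter_filter) simp
    also have "\<dots> = (\<Sum>R\<in>?R. of_bool (R \<subseteq> I) * of_bool (R \<subseteq> J))"
      by (intro sum.cong refl) simp
    finally show ?thesis .
  qed
  have super: "(\<Sum>I\<in>?P. of_bool (R \<subseteq> I)) = real ((k - r) choose (p - r))" if "R \<in> ?R" for R
    using card_supersets_of_card[OF that assms(1)] by (simp add: of_bool_def sum.If_cases Int_def)
  have "(\<Sum>I\<in>?P. \<Sum>J\<in>?P. real (card (I \<inter> J) choose r))
      = (\<Sum>I\<in>?P. \<Sum>J\<in>?P. \<Sum>R\<in>?R. of_bool (R \<subseteq> I) * of_bool (R \<subseteq> J))"
    by (intro sum.cong refl count)
  also have "\<dots> = (\<Sum>I\<in>?P. \<Sum>R\<in>?R. \<Sum>J\<in>?P. of_bool (R \<subseteq> I) * of_bool (R \<subseteq> J))"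
    by (intro sum.cong refl sum.swap)
  also have "\<dots> = (\<Sum>R\<in>?R. \<Sum>I\<in>?P. \<Sum>J\<in>?P. of_bool (R \<subseteq> I) * of_bool (R \<subseteq> J))"
    by (rule sum.swap)
  also have "\<dots> = (\<Sum>R\<in>?R. (real ((k - r) choose (p - r)))\<^sup>2)"
    by (intro sum.cong refl) (simp only: sum_product[symmetric] super power2_eq_square)
  also have "\<dots> = real (k choose r) * (real ((k - r) choose (p - r)))\<^sup>2"
    by (simp add: card_subsets_of_card)
  finally have *: "(\<Sum>I\<in>?P. \<Sum>J\<in>?P. real (card (I \<inter> J) choose r)) = \<dots>" .
  \<comment> \<open>Counting pairs of an \<open>r\<close>-subset inside a \<open>p\<close>-subset in
    two ways eliminates \<open>(k - r) choose (p - r)\<close>.\<close>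
  have "real (k choose p) * real (p choose r) = real (k choose r) * real ((k - r) choose (p - r))"
    using choose_mult[OF assms] by (metis of_nat_mult)
  moreover have "real (k choose r) > 0" using assms by simp
  ultimately show ?thesis
    unfolding * by (simp add: field_simps power2_eq_square)
qed

text \<open>With \<open>s = card (I \<inter> J)\<close>, the majorant is \<open>2 * t * (s choose 1)
  + 2 * (t + u) * (s choose 2) + K * (s choose 3)\<close>. It equals \<open>2 * t\<close> at
  \<open>s = 1\<close> and \<open>6 * t + 2 * u\<close> at \<open>s = 2\<close>, and for
  \<open>s \<ge> 3\<close> its last term is at least \<open>K\<close>. Averaging and expanding the
  reciprocal binomials in \<open>1 / k\<close> gives the claim.\<close>

lemma hypergeometric_sum_bound:
  fixes f :: "nat set \<Rightarrow> nat set \<Rightarrow> real"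
  assumes k: "k \<ge> 3" "p \<le> k" and p: "p \<ge> 1" and nn: "t \<ge> 0" "u \<ge> 0" "K \<ge> 0"
    and f0: "\<And>I J. I \<in> subsets_of_card k p \<Longrightarrow> J \<in> subsets_of_card k p \<Longrightarrow> card (I \<inter> J) = 0 \<Longrightarrow> f I J \<le> 0"
    and f1: "\<And>I J. I \<in> subsets_of_card k p \<Longrightarrow> J \<in> subsets_of_card k p \<Longrightarrow> card (I \<inter> J) = 1 \<Longrightarrow> f I J \<le> 2 * t"
    and f2: "\<And>I J. I \<in> subsets_of_card k p \<Longrightarrow> J \<in> subsets_of_card k p \<Longrightarrow> card (I \<inter> J) = 2 \<Longrightarrow> f I J \<le> 6 * t + 2 * u"
    and f3: "\<And>I J. I \<in> subsets_of_card k p \<Longrightarrow> J \<in> subsets_of_card k p \<Longrightarrow> card (I \<inter> J) \<ge> 3 \<Longrightarrow> f I J \<le> K"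
  shows "(\<Sum>I\<in>subsets_of_card k p. \<Sum>J\<in>subsets_of_card k p. f I J) / (real (k choose p))\<^sup>2
    \<le> 2 * t * (real p)\<^sup>2 / real k + (t + u) * ((real p)\<^sup>2 * (real p - 1)\<^sup>2) / (real k)\<^sup>2
      + (2 * (t + u) * ((real p)\<^sup>2 * (real p - 1)\<^sup>2) + 36 * K * (real (p choose 3))\<^sup>2) / (real k) ^ 3"
proof -
  let ?P = "subsets_of_card k p"
  let ?N = "(real (k choose p))\<^sup>2"
  have N: "?N > 0" using k by simp
  \<comment> \<open>For \<open>r > p\<close> both sides vanish; this serves \<open>p = 1\<close> and
    \<open>p = 2\<close>, where the terms with \<open>r = 2\<close> or \<open>r = 3\<close> are
    still written.\<close>
  have choose: "(\<Sum>I\<in>?P. \<Sum>J\<in>?P. real (card (I \<inter> J) choose r)) = ?N * ((real (p choose r))\<^sup>2 / real (k choose r))" for r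
  proof (cases "r \<le> p")
    case True
    then show ?thesis using sum_card_inter_choose[of r p k] k by simp
  next
    case False
    have "card (I \<inter> J) choose r = 0" if "I \<in> ?P" for I J
    proof -
      have "finite I" "card I = p" using that by (auto simp: subsets_of_card_def intro: finite_subset)
      then have "card (I \<inter> J) \<le> p" by (metis card_mono Int_lower1)
      then show ?thesis using False by simp
    qed
    with False show ?thesis by simp
  qed
  have pt: "f I J \<le> 2 * t * real (card (I \<inter> J) choose 1) + 2 * (t + u) * real (card (I \<inter> J) choose 2)
      + K * real (card (I \<inter> J) choose 3)" if "I \<in> ?P" "J \<in> ?P" for I J
  proof -
    consider "card (I \<inter> J) = 0" | "card (I \<inter> J) = 1" | "card (I \<inter> J) = 2" | "card (I \<inter> J) \<ge> 3"
      by linarith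
    then show ?thesis
    proof cases
      case 4
      then have "1 \<le> card (I \<inter> J) choose 3" by (simp add: Suc_leI)
      then have "K * 1 \<le> K * real (card (I \<inter> J) choose 3)" using nn by (intro mult_left_mono) auto
      moreover have "0 \<le> 2 * t * real (card (I \<inter> J) choose 1)" "0 \<le> 2 * (t + u) * real (card (I \<inter> J) choose 2)"
        using nn by auto
      ultimately show ?thesis using f3[OF that 4] by linarith
    qed (use f0[OF that] f1[OF that] f2[OF that] nn in \<open>simp_all add: choose_two binomial_eq_0\<close>)
  qed
  have "(\<Sum>I\<in>?P. \<Sum>J\<in>?P. f I J) \<le> (\<Sum>I\<in>?P. \<Sum>J\<in>?P. 2 * t * real (card (I \<inter> J) choose 1)
      + 2 * (t + u) * real (card (I \<inter> J) choose 2) + K * real (card (I \<inter> J) choose 3))"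
    by (intro sum_mono pt)
  also have "\<dots> = ?N * (2 * t * ((real (p choose 1))\<^sup>2 / real (k choose 1))
      + 2 * (t + u) * ((real (p choose 2))\<^sup>2 / real (k choose 2)) + K * ((real (p choose 3))\<^sup>2 / real (k choose 3)))"
    by (simp only: sum.distrib sum_distrib_left[symmetric] choose) (simp add: algebra_simps)
  finally have "(\<Sum>I\<in>?P. \<Sum>J\<in>?P. f I J) / ?N \<le> 2 * t * ((real (p choose 1))\<^sup>2 / real (k choose 1))
      + 2 * (t + u) * ((real (p choose 2))\<^sup>2 / real (k choose 2)) + K * ((real (p choose 3))\<^sup>2 / real (k choose 3))"
    using N by (simp add: divide_le_eq mult.commute)
  also have "2 * t * ((real (p choose 1))\<^sup>2 / real (k choose 1)) = 2 * t * (real p)\<^sup>2 / real k" by simp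
  also have "2 * (t + u) * ((real (p choose 2))\<^sup>2 / real (k choose 2))
      = (t + u) * ((real p)\<^sup>2 * (real p - 1)\<^sup>2) / (real k * (real k - 1))"
  proof -
    have c2: "real (i choose 2) = real i * (real i - 1) / 2" if "i \<ge> 1" for i
      using that binomial_gbinomial[of i 2, where ?'a = real] by (simp add: gbinomial_prod_rev numeral_2_eq_2)
    show ?thesis using k p by (simp add: c2 power2_eq_square field_simps)
  qed
  also have "\<dots> \<le> (t + u) * ((real p)\<^sup>2 * (real p - 1)\<^sup>2) * (1 / (real k)\<^sup>2 + 2 / (real k) ^ 3)"
  proof -
    \<comment> \<open>The excess over \<open>1 / k^2\<close> is \<open>1 / (k^2 * (k - 1))\<close>,
      at most \<open>2 / k^3\<close> since \<open>k \<le> 2 * (k - 1)\<close>. It moves into the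
      third-order term.\<close>
    have "1 / (real k * (real k - 1)) \<le> 1 / (real k)\<^sup>2 + 2 / (real k) ^ 3"
      using k by (simp add: field_simps power2_eq_square power3_eq_cube)
    then have "(t + u) * ((real p)\<^sup>2 * (real p - 1)\<^sup>2) * (1 / (real k * (real k - 1)))
        \<le> (t + u) * ((real p)\<^sup>2 * (real p - 1)\<^sup>2) * (1 / (real k)\<^sup>2 + 2 / (real k) ^ 3)"
      using nn by (intro mult_left_mono) auto
    then show ?thesis by simp
  qed
  also have "K * ((real (p choose 3))\<^sup>2 / real (k choose 3)) \<le> K * ((real (p choose 3))\<^sup>2 * (36 / (real k) ^ 3))"
  proof -
    have c3: "real (k choose 3) = real k * (real k - 1) * (real k - 2) / 6"
      using binomial_gbinomial[of k 3, where ?'a = real] by (simp add: gbinomial_prod_rev numeral_3_eq_3 fact_numeral mult.assoc algebra_simps)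
    \<comment> \<open>For \<open>k \<ge> 3\<close> one has \<open>k \<le> 2 * (k - 1)\<close> and
      \<open>k \<le> 3 * (k - 2)\<close>; with the factorial 6 this makes 36.\<close>
    have "(real k) ^ 3 \<le> 36 * real (k choose 3)"
    proof -
      have "real k * real k \<le> (2 * (real k - 1)) * (3 * (real k - 2))"
        using k by (intro mult_mono) auto
      then have "real k * (real k * real k) \<le> real k * ((2 * (real k - 1)) * (3 * (real k - 2)))"
        by (intro mult_left_mono) auto
      moreover have "real k * ((2 * (real k - 1)) * (3 * (real k - 2))) = 36 * real (k choose 3)"
        by (simp add: c3) (simp add: algebra_simps)
      ultimately show ?thesis by (simp add: power3_eq_cube mult.assoc)
    qed
    then have "1 / real (k choose 3) \<le> 36 / (real k) ^ 3"
      using k by (simp add: field_simps)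
    then have "K * (real (p choose 3))\<^sup>2 * (1 / real (k choose 3)) \<le> K * (real (p choose 3))\<^sup>2 * (36 / (real k) ^ 3)"
      using nn by (intro mult_left_mono) auto
    then show ?thesis by (simp add: mult.assoc)
  qed
  finally show ?thesis by (simp add: algebra_simps add_divide_distrib)
qed

section \<open>Moments of polynomials in independent Gaussians\<close>

text \<open>Asking for all absolute moments, not just integrability, gives a class closed under
  products: the \<open>r\<close>-th moment of \<open>f * g\<close> is controlled by the moments of
  order \<open>2 * r\<close> of \<open>f\<close> and \<open>g\<close>. Every polynomial in the
  Gaussian entries then lies in the class.\<close>

definition all_moments :: "'a measure \<Rightarrow> ('a \<Rightarrow> real) \<Rightarrow> bool" where
  "all_moments M f \<longleftrightarrow> f \<in> borel_measurable M \<and> (\<forall>r::nat. integrable M (\<lambda>x. \<bar>f x\<bar> ^ r))"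

lemma all_moments_integrable: "all_moments M f \<Longrightarrow> integrable M f"
  unfolding all_moments_def by (auto dest: spec[where x = 1] simp: integrable_abs_iff)

lemma all_moments_const [intro, simp]: "finite_measure M \<Longrightarrow> all_moments M (\<lambda>_. c)"
  by (simp add: all_moments_def finite_measure.integrable_const)

lemma all_moments_add [intro]:
  assumes "all_moments M f" "all_moments M g"
  shows "all_moments M (\<lambda>x. f x + g x)"
  unfolding all_moments_def
proof (intro conjI allI)
  have [measurable]: "f \<in> borel_measurable M" "g \<in> borel_measurable M"
    using assms by (auto simp: all_moments_def)
  show "(\<lambda>x. f x + g x) \<in> borel_measurable M" by measurable
  fix r :: nat
  have "integrable M (\<lambda>x. 2 ^ r * (\<bar>f x\<bar> ^ r + \<bar>g x\<bar> ^ r))"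
    using assms by (auto simp: all_moments_def)
  then show "integrable M (\<lambda>x. \<bar>f x + g x\<bar> ^ r)"
  proof (rule Bochner_Integration.integrable_bound)
    have "\<bar>f x + g x\<bar> ^ r \<le> 2 ^ r * (\<bar>f x\<bar> ^ r + \<bar>g x\<bar> ^ r)" for x
    proof -
      have "\<bar>f x + g x\<bar> ^ r \<le> (2 * max \<bar>f x\<bar> \<bar>g x\<bar>) ^ r" by (intro power_mono) auto
      also have "\<dots> = 2 ^ r * max \<bar>f x\<bar> \<bar>g x\<bar> ^ r" by (simp add: power_mult_distrib)
      also have "\<dots> \<le> 2 ^ r * (\<bar>f x\<bar> ^ r + \<bar>g x\<bar> ^ r)"
        by (intro mult_left_mono) (auto simp: max_def)
      finally show ?thesis .
    qed
    then show "AE x in M. norm (\<bar>f x + g x\<bar> ^ r) \<le> norm (2 ^ r * (\<bar>f x\<bar> ^ r + \<bar>g x\<bar> ^ r))"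
      by (intro always_eventually) (auto simp: abs_mult intro: order.trans[OF _ abs_ge_self])
  qed measurable
qed

lemma all_moments_mult [intro]:
  assumes "all_moments M f" "all_moments M g"
  shows "all_moments M (\<lambda>x. f x * g x)"
  unfolding all_moments_def
proof (intro conjI allI)
  have [measurable]: "f \<in> borel_measurable M" "g \<in> borel_measurable M"
    using assms by (auto simp: all_moments_def)
  show "(\<lambda>x. f x * g x) \<in> borel_measurable M" by measurable
  fix r :: nat
  have "integrable M (\<lambda>x. \<bar>f x\<bar> ^ (2 * r) + \<bar>g x\<bar> ^ (2 * r))"
    using assms unfolding all_moments_def by (intro Bochner_Integration.integrable_add) blast+
  then show "integrable M (\<lambda>x. \<bar>f x * g x\<bar> ^ r)"
  proof (rule Bochner_Integration.integrable_bound)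
    have "\<bar>f x * g x\<bar> ^ r \<le> \<bar>f x\<bar> ^ (2 * r) + \<bar>g x\<bar> ^ (2 * r)" for x
    proof -
      have "2 * (\<bar>f x\<bar> ^ r * \<bar>g x\<bar> ^ r) \<le> (\<bar>f x\<bar> ^ r)\<^sup>2 + (\<bar>g x\<bar> ^ r)\<^sup>2"
        using sum_squares_bound[of "\<bar>f x\<bar> ^ r" "\<bar>g x\<bar> ^ r"] by simp
      moreover have "0 \<le> \<bar>f x\<bar> ^ r * \<bar>g x\<bar> ^ r" by simp
      ultimately show ?thesis
        unfolding abs_mult power_mult_distrib power_mult[symmetric] mult.commute[of 2] by linarith
    qed
    then show "AE x in M. norm (\<bar>f x * g x\<bar> ^ r) \<le> norm (\<bar>f x\<bar> ^ (2 * r) + \<bar>g x\<bar> ^ (2 * r))"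
      by (intro always_eventually allI) (simp del: abs_mult)
  qed measurable
qed

lemma all_moments_sum [intro]:
  assumes "finite_measure M" "\<And>i. i \<in> I \<Longrightarrow> all_moments M (f i)"
  shows "all_moments M (\<lambda>x. \<Sum>i\<in>I. f i x)"
  using assms(2) by (induction I rule: infinite_finite_induct) (auto intro: assms(1))

lemma all_moments_power [intro]:
  assumes "finite_measure M" "all_moments M f"
  shows "all_moments M (\<lambda>x. f x ^ r)"
  by (induction r) (use assms in auto)

section \<open>The standard Gaussian and its first four moments\<close>

abbreviation std_gaussian :: "real measure" where
  "std_gaussian \<equiv> density lborel (\<lambda>x. ennreal (std_normal_density x))"

lemma prob_space_std_gaussian: "prob_space std_gaussian"
  using prob_space_normal_density[of 1 0] by simp

lemma integrable_std_gaussian_abs_power: "integrable std_gaussian (\<lambda>x. \<bar>x\<bar> ^ r)"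
  by (subst integrable_density) (auto simp: integrable_std_normal_moment_abs)

lemma integral_std_gaussian_power:
  "(\<integral>x. x ^ r \<partial>std_gaussian) = (\<integral>x. std_normal_density x * x ^ r \<partial>lborel)"
  by (subst integral_density) auto

lemma std_gaussian_moments:
  "(\<integral>x. x \<partial>std_gaussian) = 0"
  "(\<integral>x. x\<^sup>2 \<partial>std_gaussian) = 1"
  "(\<integral>x. x ^ 3 \<partial>std_gaussian) = 0"
  "(\<integral>x. x ^ 4 \<partial>std_gaussian) = 3"
proof -
  show "(\<integral>x. x \<partial>std_gaussian) = 0"
    using integral_std_gaussian_power[of 1] integral_std_normal_moment_odd[of 0] by simp
  show "(\<integral>x. x\<^sup>2 \<partial>std_gaussian) = 1"
    using integral_std_gaussian_power[of 2] integral_std_normal_moment_even[of 1] by simp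
  show "(\<integral>x. x ^ 3 \<partial>std_gaussian) = 0"
    using integral_std_gaussian_power[of 3] integral_std_normal_moment_odd[of 1] by simp
  show "(\<integral>x. x ^ 4 \<partial>std_gaussian) = 3"
    using integral_std_gaussian_power[of 4] integral_std_normal_moment_even[of 2]
    by (simp add: fact_numeral)
qed

lemma sum_of_bool_delta:
  fixes f :: "nat \<Rightarrow> real"
  assumes "a \<in> {..<n}"
  shows "(\<Sum>b<n. of_bool (a = b) * f b) = f a"
proof -
  have "(\<Sum>b<n. of_bool (a = b) * f b) = (\<Sum>b<n. if a = b then f b else 0)"
    by (intro sum.cong) auto
  then show ?thesis using assms by simp
qed

text \<open>A pointwise substitute for independence from column \<open>c\<close>: changing any entry
  of that column leaves \<open>H\<close> unchanged. This is the form in which Fubini on the product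
  measure uses it.\<close>

definition free_col :: "nat \<Rightarrow> ((nat \<times> nat \<Rightarrow> real) \<Rightarrow> real) \<Rightarrow> bool" where
  "free_col c H \<longleftrightarrow> (\<forall>\<omega> a y. H (fun_upd \<omega> (a, c) y) = H \<omega>)"

lemma free_colD: "free_col c H \<Longrightarrow> H (fun_upd \<omega> (a, c) y) = H \<omega>"
  by (simp add: free_col_def)

lemma free_col_intros [intro]:
  "free_col c (\<lambda>_. x)"
  "c \<noteq> d \<Longrightarrow> free_col c (\<lambda>\<omega>. \<omega> (a, d))"
  "free_col c f \<Longrightarrow> free_col c g \<Longrightarrow> free_col c (\<lambda>\<omega>. f \<omega> * g \<omega>)"
  "(\<And>i. i \<in> I \<Longrightarrow> free_col c (h i)) \<Longrightarrow> free_col c (\<lambda>\<omega>. \<Sum>i\<in>I. h i \<omega>)"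
  by (simp_all add: free_col_def)

section \<open>Wick's formula for one column of the Gaussian matrix\<close>

locale gaussian_matrix =
  fixes n k :: nat
begin

abbreviation "P \<equiv> gaussian_entries n k"

sublocale prob_space P
  unfolding gaussian_entries_def by (intro prob_space_PiM prob_space_std_gaussian)

lemma finite_measure_P: "finite_measure P" by unfold_locales

abbreviation "moments \<equiv> all_moments P"

lemma moments_coordinate [intro]:
  assumes "a < n" "c < k"
  shows "moments (\<lambda>\<omega>. \<omega> (a, c))"
  unfolding all_moments_def
proof (intro conjI allI)
  have e: "(a, c) \<in> {..<n} \<times> {..<k}" using assms by auto
  show "(\<lambda>\<omega>. \<omega> (a, c)) \<in> borel_measurable P"
    using measurable_component_singleton[OF e, of "\<lambda>_. std_gaussian"]
    by (simp add: gaussian_entries_def cong: measurable_cong_sets)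
  fix r :: nat
  interpret N: prob_space std_gaussian by (rule prob_space_std_gaussian)
  interpret product_sigma_finite "\<lambda>_::nat \<times> nat. std_gaussian" by unfold_locales
  \<comment> \<open>The power of one coordinate is written as a product over all coordinates with
    the other factors equal to 1, so that the integrability of products of one-variable functions
    applies.\<close>
  have "integrable (Pi\<^sub>M ({..<n} \<times> {..<k}) (\<lambda>_. std_gaussian))
      (\<lambda>\<omega>. \<Prod>i\<in>{..<n} \<times> {..<k}. (if i = (a, c) then \<bar>\<omega> i\<bar> ^ r else 1))"
  proof (intro product_integrable_prod[where f = "\<lambda>i x. if i = (a, c) then \<bar>x\<bar> ^ r else 1"])
    show "integrable std_gaussian (\<lambda>x. if i = (a, c) then \<bar>x\<bar> ^ r else 1)" for i
      by (cases "i = (a, c)") (simp_all add: integrable_std_gaussian_abs_power)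
  qed simp
  then show "integrable P (\<lambda>\<omega>. \<bar>\<omega> (a, c)\<bar> ^ r)"
    using e by (simp add: gaussian_entries_def)
qed

lemmas moments_intros = all_moments_const[OF finite_measure_P] all_moments_add all_moments_mult
  all_moments_sum[OF finite_measure_P]
  all_moments_power[OF finite_measure_P] moments_coordinate

text \<open>Fubini splits off the coordinate \<open>(a, c)\<close>, along which \<open>H\<close> is
  constant.\<close>

lemma expectation_coordinate_power:
  assumes ac: "a < n" "c < k" and H: "moments H" and free: "\<And>\<omega> y. H (fun_upd \<omega> (a, c) y) = H \<omega>"
  shows "expectation (\<lambda>\<omega>. \<omega> (a, c) ^ r * H \<omega>) = (\<integral>x. x ^ r \<partial>std_gaussian) * expectation H"
proof -
  interpret N: prob_space std_gaussian by (rule prob_space_std_gaussian)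
  interpret product_sigma_finite "\<lambda>_::nat \<times> nat. std_gaussian" by unfold_locales
  define I where "I = {..<n} \<times> {..<k} - {(a, c)}"
  have P: "P = Pi\<^sub>M (insert (a, c) I) (\<lambda>_. std_gaussian)"
    using ac by (simp add: I_def gaussian_entries_def insert_absorb)
  have I: "finite I" "(a, c) \<notin> I" by (auto simp: I_def)
  have split: "expectation (\<lambda>\<omega>. \<omega> (a, c) ^ r * H \<omega>)
      = (\<integral>x. x ^ r \<partial>std_gaussian) * (\<integral>\<omega>. H \<omega> \<partial>Pi\<^sub>M I (\<lambda>_. std_gaussian))" for r
  proof -
    have "integrable P (\<lambda>\<omega>. \<omega> (a, c) ^ r * H \<omega>)"
      using ac H by (intro all_moments_integrable moments_intros)
    from product_integral_insert[OF I this[unfolded P]] show ?thesis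
      by (simp add: P free)
  qed
  \<comment> \<open>The splitting at \<open>r = 0\<close> identifies the integral of
    \<open>H\<close> over the remaining coordinates with its full expectation.\<close>
  have "(\<integral>x. x ^ 0 \<partial>std_gaussian) = 1" using N.prob_space by simp
  then have "expectation H = (\<integral>\<omega>. H \<omega> \<partial>Pi\<^sub>M I (\<lambda>_. std_gaussian))"
    using split[of 0] by simp
  then show ?thesis using split[of r] by simp
qed

lemma expectation_coordinate:
  assumes "a < n" "c < k" "moments H" "\<And>\<omega> y. H (fun_upd \<omega> (a, c) y) = H \<omega>"
  shows "expectation (\<lambda>\<omega>. \<omega> (a, c) * H \<omega>) = 0"
  using expectation_coordinate_power[OF assms, of 1] by (simp add: std_gaussian_moments)

lemma wick2:
  assumes ab: "a < n" "b < n" and c: "c < k" and H: "moments H" "free_col c H"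
  shows "expectation (\<lambda>\<omega>. \<omega> (a, c) * \<omega> (b, c) * H \<omega>) = of_bool (a = b) * expectation H"
proof (cases "a = b")
  case True
  then show ?thesis
    using expectation_coordinate_power[OF ab(1) c H(1), of 2] free_colD[OF H(2)]
    by (simp add: std_gaussian_moments flip: power2_eq_square)
next
  case False
  then have "expectation (\<lambda>\<omega>. \<omega> (a, c) * (\<omega> (b, c) * H \<omega>)) = 0"
    using ab c H free_colD[OF H(2)] by (intro expectation_coordinate moments_intros) auto
  with False show ?thesis by (simp add: mult.assoc)
qed

text \<open>The three indicators are the pairings of four indices. An index different from the other
  three makes the expectation vanish; two distinct pairs give 1 through second moments; four equal
  indices give the fourth moment 3, all three pairings being present.\<close>

lemma wick4_single:
  assumes ab: "a < n" "b < n" "d < n" "e < n" and c: "c < k" and H: "moments H" "free_col c H"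
  shows "expectation (\<lambda>\<omega>. \<omega> (a, c) * \<omega> (b, c) * \<omega> (d, c) * \<omega> (e, c) * H \<omega>)
    = (of_bool (a = b \<and> d = e) + of_bool (a = d \<and> b = e) + of_bool (a = e \<and> b = d)) * expectation H"
proof -
  have alone: "expectation (\<lambda>\<omega>. \<omega> (i, c) * (\<omega> (j, c) * \<omega> (l, c) * \<omega> (m, c) * H \<omega>)) = 0"
    if "i < n" "j < n" "l < n" "m < n" "i \<noteq> j" "i \<noteq> l" "i \<noteq> m" for i j l m
    using that c H free_colD[OF H(2)] by (intro expectation_coordinate moments_intros) auto
  have pair: "expectation (\<lambda>\<omega>. \<omega> (i, c) ^ 2 * (\<omega> (j, c) * \<omega> (l, c) * H \<omega>)) = of_bool (j = l) * expectation H"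
    if "i < n" "j < n" "l < n" "i \<noteq> j" "i \<noteq> l" for i j l
  proof -
    have "moments (\<lambda>\<omega>. \<omega> (j, c) * \<omega> (l, c) * H \<omega>)"
      using that c H by (intro moments_intros)
    from expectation_coordinate_power[OF that(1) c this, of 2] show ?thesis
      using that c H free_colD[OF H(2)] wick2[of j l c H] by (simp add: std_gaussian_moments)
  qed
  have four: "expectation (\<lambda>\<omega>. \<omega> (a, c) ^ 4 * H \<omega>) = 3 * expectation H"
    using expectation_coordinate_power[OF ab(1) c H(1), of 4] free_colD[OF H(2)]
    by (simp add: std_gaussian_moments)
  show ?thesis
  proof (cases "a = b")
    case True
    show ?thesis
    proof (cases "a = d")
      case ad: True
      show ?thesis
      proof (cases "a = e")
        case ae: True
        show ?thesis using four True ad ae by (simp add: power4_eq_xxxx mult.assoc)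
      next
        case False
        then show ?thesis using alone[of e a a a] ab True ad by (simp add: mult_ac)
      qed
    next
      case ad: False
      show ?thesis
      proof (cases "a = e")
        case ae: True
        then show ?thesis using alone[of d a a a] ab True ad by (simp add: mult_ac)
      next
        case False
        then show ?thesis using pair[of a d e] ab True ad by (simp add: power2_eq_square mult_ac)
      qed
    qed
  next
    case b: False
    show ?thesis
    proof (cases "a = d")
      case ad: True
      show ?thesis
      proof (cases "a = e")
        case ae: True
        then show ?thesis using alone[of b a a a] ab b ad by (simp add: mult_ac)
      next
        case False
        then show ?thesis using pair[of a b e] ab b ad by (simp add: power2_eq_square mult_ac)
      qed
    next
      case ad: False
      show ?thesis
      proof (cases "a = e")
        case ae: True
        then show ?thesis using pair[of a b d] ab b ad by (simp add: power2_eq_square mult_ac)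
      next
        case False
        then show ?thesis using alone[of a b d e] ab b ad by (simp add: mult_ac)
      qed
    qed
  qed
qed

lemma expectation_sum:
  assumes "\<And>i. i \<in> I \<Longrightarrow> moments (f i)"
  shows "expectation (\<lambda>\<omega>. \<Sum>i\<in>I. f i \<omega>) = (\<Sum>i\<in>I. expectation (f i))"
  by (intro Bochner_Integration.integral_sum all_moments_integrable assms)

text \<open>The coefficients may be random as long as they do not involve column \<open>c\<close>.
  In matrix terms, the outer product of the column with itself is replaced by its mean, the
  identity.\<close>

lemma wick_quadratic:
  assumes c: "c < k" and K: "\<And>a b. a < n \<Longrightarrow> b < n \<Longrightarrow> moments (K a b)"
    "\<And>a b. a < n \<Longrightarrow> b < n \<Longrightarrow> free_col c (K a b)"
  shows "expectation (\<lambda>\<omega>. \<Sum>a<n. \<Sum>b<n. \<omega> (a, c) * \<omega> (b, c) * K a b \<omega>)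
    = expectation (\<lambda>\<omega>. \<Sum>a<n. K a a \<omega>)"
proof -
  have m: "moments (\<lambda>\<omega>. \<omega> (a, c) * \<omega> (b, c) * K a b \<omega>)" if "a < n" "b < n" for a b
    using that c K(1) by (intro moments_intros) auto
  have "expectation (\<lambda>\<omega>. \<Sum>a<n. \<Sum>b<n. \<omega> (a, c) * \<omega> (b, c) * K a b \<omega>)
      = (\<Sum>a<n. expectation (\<lambda>\<omega>. \<Sum>b<n. \<omega> (a, c) * \<omega> (b, c) * K a b \<omega>))"
    by (intro expectation_sum moments_intros m) auto
  also have "\<dots> = (\<Sum>a<n. \<Sum>b<n. expectation (\<lambda>\<omega>. \<omega> (a, c) * \<omega> (b, c) * K a b \<omega>))"
    by (intro sum.cong refl expectation_sum m) auto
  also have "\<dots> = (\<Sum>a<n. \<Sum>b<n. of_bool (a = b) * expectation (K a b))"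
    using c K by (intro sum.cong refl wick2) auto
  also have "\<dots> = (\<Sum>a<n. expectation (K a a))"
    by (intro sum.cong refl sum_of_bool_delta)
  also have "\<dots> = expectation (\<lambda>\<omega>. \<Sum>a<n. K a a \<omega>)"
    using K(1) by (intro expectation_sum[symmetric]) auto
  finally show ?thesis .
qed

text \<open>Four copies of column \<open>c\<close> contracted against a random tensor
  \<open>K\<close> free of that column: each of the three pairings identifies the indices in two
  pairs.\<close>

lemma wick_quartic:
  assumes c: "c < k" and K: "\<And>a b d e. a < n \<Longrightarrow> b < n \<Longrightarrow> d < n \<Longrightarrow> e < n \<Longrightarrow> moments (K a b d e)"
    "\<And>a b d e. a < n \<Longrightarrow> b < n \<Longrightarrow> d < n \<Longrightarrow> e < n \<Longrightarrow> free_col c (K a b d e)"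
  shows "expectation (\<lambda>\<omega>. \<Sum>a<n. \<Sum>b<n. \<Sum>d<n. \<Sum>e<n.
      \<omega> (a, c) * \<omega> (b, c) * \<omega> (d, c) * \<omega> (e, c) * K a b d e \<omega>)
    = expectation (\<lambda>\<omega>. \<Sum>a<n. \<Sum>b<n. K a a b b \<omega> + K a b a b \<omega> + K a b b a \<omega>)"
proof -
  let ?m = "\<lambda>a b d e \<omega>. \<omega> (a, c) * \<omega> (b, c) * \<omega> (d, c) * \<omega> (e, c) * K a b d e \<omega>"
  have m: "moments (?m a b d e)" if "a < n" "b < n" "d < n" "e < n" for a b d e
    using that c K(1) by (intro moments_intros) auto
  have "expectation (\<lambda>\<omega>. \<Sum>a<n. \<Sum>b<n. \<Sum>d<n. \<Sum>e<n. ?m a b d e \<omega>)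
    = (\<Sum>a<n. expectation (\<lambda>\<omega>. \<Sum>b<n. \<Sum>d<n. \<Sum>e<n. ?m a b d e \<omega>))"
    by (intro expectation_sum all_moments_sum[OF finite_measure_P] m) auto
  also have "\<dots> = (\<Sum>a<n. \<Sum>b<n. expectation (\<lambda>\<omega>. \<Sum>d<n. \<Sum>e<n. ?m a b d e \<omega>))"
    by (intro sum.cong refl expectation_sum all_moments_sum[OF finite_measure_P] m) auto
  also have "\<dots> = (\<Sum>a<n. \<Sum>b<n. \<Sum>d<n. expectation (\<lambda>\<omega>. \<Sum>e<n. ?m a b d e \<omega>))"
    by (intro sum.cong refl expectation_sum all_moments_sum[OF finite_measure_P] m) auto
  also have "\<dots> = (\<Sum>a<n. \<Sum>b<n. \<Sum>d<n. \<Sum>e<n. expectation (?m a b d e))"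
    by (intro sum.cong refl expectation_sum m) auto
  also have "\<dots> = (\<Sum>a<n. \<Sum>b<n. \<Sum>d<n. \<Sum>e<n.
      (of_bool (a = b \<and> d = e) + of_bool (a = d \<and> b = e) + of_bool (a = e \<and> b = d)) * expectation (K a b d e))"
    using c K by (intro sum.cong refl wick4_single) auto
  also have "\<dots> = (\<Sum>a<n. \<Sum>b<n. expectation (K a a b b) + expectation (K a b a b) + expectation (K a b b a))"
  proof -
    have 1: "(\<Sum>b<n. \<Sum>d<n. \<Sum>e<n. of_bool (a = b) * (of_bool (d = e) * expectation (K a b d e)))
        = (\<Sum>b<n. expectation (K a a b b))" if "a \<in> {..<n}" for a
      using that by (simp only: sum_distrib_left[symmetric] sum_of_bool_delta cong: sum.cong)
    have 2: "(\<Sum>d<n. \<Sum>e<n. of_bool (a = d) * (of_bool (b = e) * expectation (K a b d e)))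
        = expectation (K a b a b)" if "a \<in> {..<n}" "b \<in> {..<n}" for a b
      using that by (simp only: sum_distrib_left[symmetric] sum_of_bool_delta cong: sum.cong)
    have 3: "(\<Sum>d<n. \<Sum>e<n. of_bool (a = e) * (of_bool (b = d) * expectation (K a b d e)))
        = expectation (K a b b a)" if "a \<in> {..<n}" "b \<in> {..<n}" for a b
      using that by (simp only: sum_of_bool_delta cong: sum.cong)
    show ?thesis
      unfolding distrib_right sum.distrib of_bool_conj mult.assoc
      by (simp only: 1 2 3 cong: sum.cong)
  qed
  also have "\<dots> = (\<Sum>a<n. \<Sum>b<n. expectation (\<lambda>\<omega>. K a a b b \<omega> + K a b a b \<omega> + K a b b a \<omega>))"
  proof (intro sum.cong refl)
    fix a b assume "a \<in> {..<n}" "b \<in> {..<n}"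
    then have [simp]: "integrable P (K a a b b)" "integrable P (K a b a b)" "integrable P (K a b b a)"
      using K(1) by (auto intro: all_moments_integrable)
    show "expectation (K a a b b) + expectation (K a b a b) + expectation (K a b b a)
        = expectation (\<lambda>\<omega>. K a a b b \<omega> + K a b a b \<omega> + K a b b a \<omega>)"
      by simp
  qed
  also have "\<dots> = (\<Sum>a<n. expectation (\<lambda>\<omega>. \<Sum>b<n. K a a b b \<omega> + K a b a b \<omega> + K a b b a \<omega>))"
    using K(1) by (intro sum.cong refl expectation_sum[symmetric] all_moments_add) auto
  also have "\<dots> = expectation (\<lambda>\<omega>. \<Sum>a<n. \<Sum>b<n. K a a b b \<omega> + K a b a b \<omega> + K a b b a \<omega>)"
    using K(1) by (intro expectation_sum[symmetric] all_moments_sum[OF finite_measure_P] all_moments_add) auto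
  finally show ?thesis .
qed

end

section \<open>Covariances of the cyclic products\<close>

locale gaussian_sketch = gaussian_matrix n k for n k :: nat +
  fixes A :: "real mat" and m :: nat
  assumes A: "A \<in> carrier_mat m n"
begin

definition M :: "real mat" where "M = A\<^sup>T * A"

lemma M_carrier: "M \<in> carrier_mat n n"
  using A by (simp add: M_def)

lemma M_pow_carrier: "M ^\<^sub>m q \<in> carrier_mat n n"
  using M_carrier by (rule pow_carrier_mat)

lemma M_pow_1: "M ^\<^sub>m Suc 0 = M"
  using M_carrier by simp

lemma mult_carrier_n: "R \<in> carrier_mat n n \<Longrightarrow> Q \<in> carrier_mat n n \<Longrightarrow> R * Q \<in> carrier_mat n n"
  by (rule mult_carrier_mat)

lemma M_entry: "a < n \<Longrightarrow> b < n \<Longrightarrow> M $$ (a, b) = (\<Sum>r<m. A $$ (r, a) * A $$ (r, b))"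
  using A by (simp add: M_def mat_mult_entry[of _ n m _ n] del: index_mult_mat(1))

lemma M_pow_add: "M ^\<^sub>m (q + r) = M ^\<^sub>m q * M ^\<^sub>m r"
proof (induction r)
  case (Suc r)
  have "M ^\<^sub>m (q + Suc r) = (M ^\<^sub>m q * M ^\<^sub>m r) * M" using Suc by simp
  also have "\<dots> = M ^\<^sub>m q * (M ^\<^sub>m r * M)"
    by (rule assoc_mult_mat[OF M_pow_carrier M_pow_carrier M_carrier])
  finally show ?case by simp
qed (use M_pow_carrier[of q] M_carrier in simp)

lemma M_pow_sym:
  assumes "a < n" "b < n"
  shows "(M ^\<^sub>m q) $$ (a, b) = (M ^\<^sub>m q) $$ (b, a)"
  using assms
proof (induction q arbitrary: a b)
  case 0
  then show ?case using M_carrier by auto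
next
  case (Suc q)
  have "(M ^\<^sub>m Suc q) $$ (a, b) = (\<Sum>d<n. (M ^\<^sub>m q) $$ (a, d) * M $$ (d, b))"
    using Suc.prems M_pow_carrier[of q] M_carrier by (simp add: mat_mult_entry[of _ n n _ n] del: index_mult_mat(1))
  also have "\<dots> = (\<Sum>d<n. M $$ (b, d) * (M ^\<^sub>m q) $$ (d, a))"
    using Suc by (intro sum.cong refl) (simp add: M_entry mult.commute)
  also have "\<dots> = (M ^\<^sub>m Suc q) $$ (b, a)"
    unfolding pow_mat_Suc_left[OF M_carrier] using Suc.prems M_pow_carrier[of q] M_carrier
    by (simp add: mat_mult_entry[of _ n n _ n] del: index_mult_mat(1))
  finally show ?case .
qed

text \<open>For \<open>q \<ge> 1\<close> this is the power sum of order \<open>q\<close> of the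
  squared singular values, while \<open>tr 0\<close> is \<open>n\<close>.\<close>

definition tr :: "nat \<Rightarrow> real" where "tr q = mat_trace (M ^\<^sub>m q)"

lemma tr_eq: "tr q = (\<Sum>a<n. (M ^\<^sub>m q) $$ (a, a))"
  using M_carrier by (simp add: tr_def mat_trace_def)

lemma tr_add: "tr (q + r) = (\<Sum>a<n. \<Sum>b<n. (M ^\<^sub>m q) $$ (a, b) * (M ^\<^sub>m r) $$ (b, a))"
  unfolding tr_eq M_pow_add using M_pow_carrier
  by (intro sum.cong refl mat_mult_entry[where r = n and s = n and n = n]) auto

text \<open>\<open>bil q a b\<close> is \<open>\<omega>\<^sub>a\<^sup>T M\<^sup>q \<omega>\<^sub>b\<close>, where \<open>\<omega>\<^sub>a\<close> is the column of index \<open>a\<close>.\<close>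
definition bil :: "nat \<Rightarrow> nat \<Rightarrow> nat \<Rightarrow> (nat \<times> nat \<Rightarrow> real) \<Rightarrow> real" where
  "bil q a b \<omega> = (\<Sum>i<n. \<Sum>j<n. \<omega> (i, a) * (M ^\<^sub>m q) $$ (i, j) * \<omega> (j, b))"

lemma bil_sym: "bil q a b \<omega> = bil q b a \<omega>"
  unfolding bil_def by (subst sum.swap) (intro sum.cong refl, simp add: M_pow_sym mult_ac)

lemma moments_bil: "a < k \<Longrightarrow> b < k \<Longrightarrow> moments (bil q a b)"
  unfolding bil_def by (intro moments_intros) auto

lemma free_col_bil: "c \<noteq> a \<Longrightarrow> c \<noteq> b \<Longrightarrow> free_col c (bil q a b)"
  unfolding bil_def by (intro free_col_intros)

text \<open>Pairing within each quadratic form gives \<open>tr q * tr r\<close>; each of the two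
  cross pairings gives \<open>tr (q + r)\<close>. The factor \<open>H\<close> allows products over
  distinct columns to be integrated one column at a time.\<close>

lemma expectation_bil_square_times:
  assumes c: "c < k" and H: "moments H" "free_col c H"
  shows "expectation (\<lambda>\<omega>. bil q c c \<omega> * bil r c c \<omega> * H \<omega>) = (tr q * tr r + 2 * tr (q + r)) * expectation H"
proof -
  define K where "K = (\<lambda>i j s t \<omega>. (M ^\<^sub>m r) $$ (i, j) * (M ^\<^sub>m q) $$ (s, t) * H \<omega>)"
  have "expectation (\<lambda>\<omega>. bil q c c \<omega> * bil r c c \<omega> * H \<omega>)
      = expectation (\<lambda>\<omega>. \<Sum>i<n. \<Sum>j<n. \<Sum>s<n. \<Sum>t<n.
          \<omega> (i, c) * \<omega> (j, c) * \<omega> (s, c) * \<omega> (t, c) * K i j s t \<omega>)"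
    unfolding bil_def K_def sum_distrib_left sum_distrib_right
    by (intro Bochner_Integration.integral_cong refl) (intro sum.cong refl, simp add: mult_ac)
  also have "\<dots> = expectation (\<lambda>\<omega>. \<Sum>i<n. \<Sum>j<n. K i i j j \<omega> + K i j i j \<omega> + K i j j i \<omega>)"
    using c H unfolding K_def by (intro wick_quartic moments_intros free_col_intros) auto
  also have "\<dots> = expectation (\<lambda>\<omega>. (tr q * tr r + 2 * tr (q + r)) * H \<omega>)"
  proof (intro Bochner_Integration.integral_cong refl)
    fix \<omega>
    have "(\<Sum>i<n. \<Sum>j<n. K i i j j \<omega> + K i j i j \<omega> + K i j j i \<omega>)
        = (\<Sum>i<n. \<Sum>j<n. (M ^\<^sub>m r) $$ (i, i) * (M ^\<^sub>m q) $$ (j, j) * H \<omega>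
            + 2 * ((M ^\<^sub>m r) $$ (i, j) * (M ^\<^sub>m q) $$ (j, i)) * H \<omega>)"
      by (intro sum.cong refl) (simp add: K_def M_pow_sym)
    also have "\<dots> = (tr q * tr r + 2 * tr (q + r)) * H \<omega>"
      unfolding add.commute[of q r] tr_add
      by (simp only: sum.distrib sum_distrib_left[symmetric] sum_distrib_right[symmetric] tr_eq[symmetric])
        (simp add: algebra_simps)
    finally show "(\<Sum>i<n. \<Sum>j<n. K i i j j \<omega> + K i j i j \<omega> + K i j j i \<omega>) = \<dots>" .
  qed
  finally show ?thesis by simp
qed

lemma expectation_bil_square:
  assumes "c < k"
  shows "expectation (\<lambda>\<omega>. bil q c c \<omega> * bil r c c \<omega>) = tr q * tr r + 2 * tr (q + r)"
  using expectation_bil_square_times[OF assms, of "\<lambda>_. 1" q r] prob_space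
  by (simp add: all_moments_const[OF finite_measure_P] free_col_intros)

text \<open>Wick's formula for column \<open>a\<close> merges the four forms in pairs into quadratic
  forms in column \<open>b\<close>, in three ways. Integrating column \<open>b\<close> gives a
  product of two traces for each way, plus twice the trace of total order; hence the coefficient
  6.\<close>

lemma expectation_bil_quartic:
  assumes ab: "a < k" "b < k" "a \<noteq> b"
  shows "expectation (\<lambda>\<omega>. bil q a b \<omega> * bil r a b \<omega> * (bil s a b \<omega> * bil t a b \<omega>))
    = tr (q + r) * tr (s + t) + tr (q + s) * tr (r + t) + tr (q + t) * tr (r + s) + 6 * tr (q + r + s + t)"
proof -
  \<comment> \<open>\<open>u q i\<close> is entry \<open>i\<close> of \<open>M ^\<^sub>m q\<close>
    applied to column \<open>b\<close>; \<open>bil q a b\<close> is linear in column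
    \<open>a\<close> with these coefficients.\<close>
  define u where "u = (\<lambda>q i \<omega>. \<Sum>j<n. (M ^\<^sub>m q) $$ (i, j) * \<omega> (j, b))"
  \<comment> \<open>The exponents appear in the order \<open>q, s, r, t\<close> because
    \<open>sum_product\<close> nests the four summation indices in this order.\<close>
  define K where "K = (\<lambda>i j i' j' \<omega>. u q i \<omega> * u s j \<omega> * u r i' \<omega> * u t j' \<omega>)"
  have u: "moments (u q i)" "free_col a (u q i)" for q i
    using ab unfolding u_def by (auto intro!: moments_intros free_col_intros)
  have bil_u: "bil q a b \<omega> = (\<Sum>i<n. \<omega> (i, a) * u q i \<omega>)" for q \<omega>
    unfolding bil_def u_def by (simp add: sum_distrib_left mult.assoc)
  have uu: "(\<Sum>i<n. u q i \<omega> * u r i \<omega>) = bil (q + r) b b \<omega>" for q r \<omega>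
  proof -
    have "(\<Sum>i<n. u q i \<omega> * u r i \<omega>)
        = (\<Sum>i<n. \<Sum>j<n. \<Sum>l<n. \<omega> (j, b) * ((M ^\<^sub>m q) $$ (j, i) * (M ^\<^sub>m r) $$ (i, l)) * \<omega> (l, b))"
      unfolding u_def sum_product by (intro sum.cong refl) (simp add: M_pow_sym[of _ _ q] mult_ac)
    also have "\<dots> = (\<Sum>j<n. \<Sum>i<n. \<Sum>l<n. \<omega> (j, b) * ((M ^\<^sub>m q) $$ (j, i) * (M ^\<^sub>m r) $$ (i, l)) * \<omega> (l, b))"
      by (rule sum.swap)
    also have "\<dots> = (\<Sum>j<n. \<Sum>l<n. \<Sum>i<n. \<omega> (j, b) * ((M ^\<^sub>m q) $$ (j, i) * (M ^\<^sub>m r) $$ (i, l)) * \<omega> (l, b))"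
      by (rule sum.cong[OF refl], rule sum.swap)
    also have "\<dots> = bil (q + r) b b \<omega>"
      unfolding bil_def M_pow_add using M_pow_carrier
      by (intro sum.cong refl, subst mat_mult_entry[where r = n and s = n and n = n])
        (auto simp: sum_distrib_left sum_distrib_right)
    finally show ?thesis .
  qed
  have "expectation (\<lambda>\<omega>. bil q a b \<omega> * bil r a b \<omega> * (bil s a b \<omega> * bil t a b \<omega>))
      = expectation (\<lambda>\<omega>. \<Sum>i<n. \<Sum>j<n. \<Sum>i'<n. \<Sum>j'<n.
          \<omega> (i, a) * \<omega> (j, a) * \<omega> (i', a) * \<omega> (j', a) * K i j i' j' \<omega>)"
    unfolding bil_u K_def sum_product unfolding sum_distrib_left sum_distrib_right
    by (intro Bochner_Integration.integral_cong refl) (intro sum.cong refl, simp add: mult_ac)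
  also have "\<dots> = expectation (\<lambda>\<omega>. \<Sum>i<n. \<Sum>j<n. K i i j j \<omega> + K i j i j \<omega> + K i j j i \<omega>)"
    using ab u unfolding K_def by (intro wick_quartic moments_intros free_col_intros) auto
  also have "\<dots> = expectation (\<lambda>\<omega>. bil (q + s) b b \<omega> * bil (r + t) b b \<omega>
      + bil (q + r) b b \<omega> * bil (s + t) b b \<omega> + bil (q + t) b b \<omega> * bil (r + s) b b \<omega>)"
    unfolding uu[symmetric] K_def sum.distrib sum_product
    by (intro Bochner_Integration.integral_cong refl arg_cong2[where f = "(+)"]) (intro sum.cong refl, simp add: mult_ac)+
  also have "\<dots> = expectation (\<lambda>\<omega>. bil (q + s) b b \<omega> * bil (r + t) b b \<omega>)
      + expectation (\<lambda>\<omega>. bil (q + r) b b \<omega> * bil (s + t) b b \<omega>)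
      + expectation (\<lambda>\<omega>. bil (q + t) b b \<omega> * bil (r + s) b b \<omega>)"
    using ab by (simp add: all_moments_integrable all_moments_mult moments_bil)
  finally show ?thesis
    using ab by (simp add: expectation_bil_square add_ac)
qed

section \<open>Cyclic products conditioned on a set of columns\<close>

definition col_outer :: "nat set \<Rightarrow> (nat \<times> nat \<Rightarrow> real) \<Rightarrow> nat \<Rightarrow> real mat" where
  "col_outer S \<omega> c = mat n n (\<lambda>(i, j). if c \<in> S then \<omega> (i, c) * \<omega> (j, c) else of_bool (i = j))"

text \<open>The cyclic product over \<open>l\<close> is the trace of \<open>\<Prod>\<^sub>c M \<omega>\<^sub>c \<omega>\<^sub>c\<^sup>T\<close>. Conditioning on the columns
  in \<open>S\<close> replaces \<open>\<omega>\<^sub>c \<omega>\<^sub>c\<^sup>T\<close> by its mean, the identity, for every \<open>c\<close> outside \<open>S\<close>.\<close>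
primrec chain :: "nat set \<Rightarrow> nat list \<Rightarrow> (nat \<times> nat \<Rightarrow> real) \<Rightarrow> real mat" where
  "chain S [] \<omega> = 1\<^sub>m n"
| "chain S (c # l) \<omega> = M * col_outer S \<omega> c * chain S l \<omega>"

definition cond_cycle :: "nat set \<Rightarrow> nat list \<Rightarrow> (nat \<times> nat \<Rightarrow> real) \<Rightarrow> real" where
  "cond_cycle S l \<omega> = mat_trace (chain S l \<omega>)"

lemma col_outer_carrier [simp]: "col_outer S \<omega> c \<in> carrier_mat n n"
  by (simp add: col_outer_def)

lemma dim_col_outer [simp]: "dim_row (col_outer S \<omega> c) = n" "dim_col (col_outer S \<omega> c) = n"
  by (simp_all add: col_outer_def)

lemma chain_carrier [simp]: "chain S l \<omega> \<in> carrier_mat n n"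
  by (induction l) (auto intro!: mult_carrier_mat M_carrier)

lemma M_outer_carrier: "M * col_outer S \<omega> c \<in> carrier_mat n n"
  by (rule mult_carrier_mat[OF M_carrier col_outer_carrier])

lemma chain_append: "chain S (l @ l') \<omega> = chain S l \<omega> * chain S l' \<omega>"
proof (induction l)
  case Nil
  then show ?case using left_mult_one_mat[OF chain_carrier] by simp
next
  case (Cons c l)
  then show ?case
    using assoc_mult_mat[OF M_outer_carrier chain_carrier chain_carrier] by simp
qed

lemma chain_cong:
  assumes "\<And>c. c \<in> set l \<Longrightarrow> c \<in> S \<longleftrightarrow> c \<in> S'"
  shows "chain S l \<omega> = chain S' l \<omega>"
  using assms by (induction l) (auto simp: col_outer_def)

lemma chain_disjoint:
  assumes "set l \<inter> S = {}"
  shows "chain S l \<omega> = M ^\<^sub>m length l"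
  using assms
proof (induction l)
  case Nil
  then show ?case using M_carrier by simp
next
  case (Cons c l)
  have "col_outer S \<omega> c = 1\<^sub>m n" using Cons.prems by (auto simp: col_outer_def)
  then show ?case using Cons M_carrier pow_mat_Suc_left[OF M_carrier] by simp
qed

lemma chain_Cons_entry:
  assumes "a < n" "b < n"
  shows "chain S (c # l) \<omega> $$ (a, b)
    = (\<Sum>d<n. (\<Sum>e<n. M $$ (a, e) * col_outer S \<omega> c $$ (e, d)) * chain S l \<omega> $$ (d, b))"
  using assms M_carrier M_outer_carrier
  by (simp add: mat_mult_entry[of _ n n _ n] del: index_mult_mat(1))

lemma moments_chain:
  assumes "a < n" "b < n" "set l \<subseteq> {..<k}"
  shows "moments (\<lambda>\<omega>. chain S l \<omega> $$ (a, b))"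
  using assms
proof (induction l arbitrary: a)
  case Nil
  then show ?case by (simp add: all_moments_const[OF finite_measure_P])
next
  case (Cons c l)
  have W: "moments (\<lambda>\<omega>. col_outer S \<omega> c $$ (e, d))" if "e < n" "d < n" for e d
    using that Cons.prems by (cases "c \<in> S") (auto simp: col_outer_def intro!: moments_intros)
  show ?case
    unfolding chain_Cons_entry[OF Cons.prems(1,2)]
    using Cons by (intro moments_intros W Cons.IH) auto
qed

lemma free_col_chain:
  assumes "a < n" "b < n" "c \<notin> set l \<inter> S"
  shows "free_col c (\<lambda>\<omega>. chain S l \<omega> $$ (a, b))"
  using assms
proof (induction l arbitrary: a)
  case Nil
  then show ?case by (simp add: free_col_intros)
next
  case (Cons d l)
  have W: "free_col c (\<lambda>\<omega>. col_outer S \<omega> d $$ (e, f))" if "e < n" "f < n" for e f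
    using that Cons.prems by (cases "d \<in> S") (auto simp: col_outer_def intro!: free_col_intros)
  show ?case
    unfolding chain_Cons_entry[OF Cons.prems(1,2)]
    using Cons by (intro free_col_intros W Cons.IH) auto
qed

lemma cond_cycle_eq: "cond_cycle S l \<omega> = (\<Sum>a<n. chain S l \<omega> $$ (a, a))"
  unfolding cond_cycle_def mat_trace_def by (simp add: carrier_matD(1)[OF chain_carrier])

lemma moments_cond_cycle: "set l \<subseteq> {..<k} \<Longrightarrow> moments (cond_cycle S l)"
  unfolding cond_cycle_eq by (intro moments_intros moments_chain) auto

lemma free_col_cond_cycle: "c \<notin> set l \<inter> S \<Longrightarrow> free_col c (cond_cycle S l)"
  unfolding cond_cycle_eq by (intro free_col_intros free_col_chain) auto

text \<open>Cyclicity brings the outer product of a chosen column to the front, where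
  \<open>trace_outer\<close> reads the trace as a quadratic form in that column.\<close>

lemma trace_rotate:
  assumes "R \<in> carrier_mat n n" "Q \<in> carrier_mat n n"
  shows "mat_trace (R * (M * col_outer S \<omega> c * Q)) = mat_trace (col_outer S \<omega> c * (Q * (R * M)))"
proof -
  let ?W = "col_outer S \<omega> c"
  have "R * (M * ?W * Q) = R * (M * (?W * Q))"
    using assoc_mult_mat[OF M_carrier col_outer_carrier assms(2)] by simp
  also have "\<dots> = (R * M) * (?W * Q)"
    by (rule assoc_mult_mat[OF assms(1) M_carrier mult_carrier_n[OF col_outer_carrier assms(2)], symmetric])
  finally have "mat_trace (R * (M * ?W * Q)) = mat_trace ((?W * Q) * (R * M))"
    using mat_trace_comm[OF mult_carrier_n[OF assms(1) M_carrier] mult_carrier_n[OF col_outer_carrier assms(2)]]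
    by simp
  also have "(?W * Q) * (R * M) = ?W * (Q * (R * M))"
    using assms M_carrier by (intro assoc_mult_mat[of _ n n _ n _ n]) auto
  finally show ?thesis .
qed

lemma trace_outer:
  assumes R: "R \<in> carrier_mat n n"
  shows "mat_trace (col_outer S \<omega> c * R)
    = (if c \<in> S then \<Sum>a<n. \<Sum>b<n. \<omega> (a, c) * \<omega> (b, c) * R $$ (b, a) else \<Sum>a<n. R $$ (a, a))"
proof (cases "c \<in> S")
  case True
  then show ?thesis using R
    by (simp add: mat_trace_def mat_mult_entry[of _ n n _ n] del: index_mult_mat(1))
      (simp add: col_outer_def)
next
  case False
  then have "col_outer S \<omega> c = 1\<^sub>m n" by (auto simp: col_outer_def)
  with False show ?thesis using R by (simp add: mat_trace_def)
qed

text \<open>A column occurs at most once in a distinct list, so the cyclic product is quadratic in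
  column \<open>c\<close> with coefficients free of it. Wick's formula then replaces the outer
  product by the identity, which is what leaving \<open>c\<close> out of \<open>S\<close>
  means.\<close>

lemma expectation_cond_cycle_insert:
  assumes c: "c \<notin> S" "c < k" and l: "set l \<subseteq> {..<k}" "distinct l"
    and G: "moments G" "free_col c G"
  shows "expectation (\<lambda>\<omega>. cond_cycle (insert c S) l \<omega> * G \<omega>) = expectation (\<lambda>\<omega>. cond_cycle S l \<omega> * G \<omega>)"
proof (cases "c \<in> set l")
  case False
  then have "cond_cycle (insert c S) l = cond_cycle S l"
    unfolding cond_cycle_def by (intro ext arg_cong[where f = mat_trace] chain_cong) auto
  then show ?thesis by simp
next
  case True
  then obtain l1 l2 where l12: "l = l1 @ c # l2" by (meson split_list)
  \<comment> \<open>The remaining factors in cyclic order, starting right after the outer product of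
    column \<open>c\<close>.\<close>
  define R where "R = (\<lambda>\<omega>. chain S l2 \<omega> * (chain S l1 \<omega> * M))"
  have Rc: "R \<omega> \<in> carrier_mat n n" for \<omega>
    unfolding R_def by (intro mult_carrier_n chain_carrier M_carrier)
  \<comment> \<open>By distinctness \<open>c\<close> lies in neither part, so the same
    \<open>R\<close> serves \<open>S\<close> and \<open>insert c S\<close>.\<close>
  have same: "chain (insert c S) l1 \<omega> = chain S l1 \<omega>" "chain (insert c S) l2 \<omega> = chain S l2 \<omega>" for \<omega>
    using l(2) unfolding l12 by (auto intro!: chain_cong)
  have split: "cond_cycle S' l \<omega> = mat_trace (col_outer S' \<omega> c * R \<omega>)" if "S' = S \<or> S' = insert c S" for S' \<omega>
    using that same trace_rotate[OF chain_carrier chain_carrier]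
    unfolding cond_cycle_def l12 R_def chain_append by auto
  have R_entry: "R \<omega> $$ (a, b) = (\<Sum>d<n. chain S l2 \<omega> $$ (a, d) * (\<Sum>e<n. chain S l1 \<omega> $$ (d, e) * M $$ (e, b)))"
    if "a < n" "b < n" for a b \<omega>
    unfolding R_def using that M_carrier
    by (simp add: mat_mult_entry[of _ n n _ n] mult_carrier_n del: index_mult_mat(1))
  have mR: "moments (\<lambda>\<omega>. R \<omega> $$ (a, b))" if "a < n" "b < n" for a b
    unfolding R_entry[OF that] using that l by (intro moments_intros moments_chain) (auto simp: l12)
  have fR: "free_col c (\<lambda>\<omega>. R \<omega> $$ (a, b))" if "a < n" "b < n" for a b
    unfolding R_entry[OF that] using that c by (intro free_col_intros free_col_chain) auto
  have "expectation (\<lambda>\<omega>. cond_cycle (insert c S) l \<omega> * G \<omega>)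
      = expectation (\<lambda>\<omega>. \<Sum>a<n. \<Sum>b<n. \<omega> (a, c) * \<omega> (b, c) * (R \<omega> $$ (b, a) * G \<omega>))"
    by (simp add: split trace_outer[OF Rc] sum_distrib_right mult.assoc)
  also have "\<dots> = expectation (\<lambda>\<omega>. \<Sum>a<n. R \<omega> $$ (a, a) * G \<omega>)"
    using mR fR G c by (intro wick_quadratic moments_intros free_col_intros) auto
  also have "\<dots> = expectation (\<lambda>\<omega>. cond_cycle S l \<omega> * G \<omega>)"
    using c by (simp add: split trace_outer[OF Rc] sum_distrib_right)
  finally show ?thesis .
qed

lemma expectation_cond_cycle_Un:
  assumes "finite D" "D \<inter> S = {}" "D \<subseteq> {..<k}" and l: "set l \<subseteq> {..<k}" "distinct l"
    and G: "moments G" "\<And>c. c \<in> D \<Longrightarrow> free_col c G"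
  shows "expectation (\<lambda>\<omega>. cond_cycle (D \<union> S) l \<omega> * G \<omega>) = expectation (\<lambda>\<omega>. cond_cycle S l \<omega> * G \<omega>)"
  using assms(1-3) G(2)
proof (induction D rule: finite_induct)
  case (insert c D)
  have "expectation (\<lambda>\<omega>. cond_cycle (insert c (D \<union> S)) l \<omega> * G \<omega>) = expectation (\<lambda>\<omega>. cond_cycle (D \<union> S) l \<omega> * G \<omega>)"
    using insert.prems insert.hyps l G(1) by (intro expectation_cond_cycle_insert) auto
  also have "\<dots> = expectation (\<lambda>\<omega>. cond_cycle S l \<omega> * G \<omega>)"
    using insert.prems by (intro insert.IH) auto
  finally show ?case by simp
qed simp

lemma cond_cycle_UNIV: "cond_cycle UNIV l = cond_cycle (set l) l"
  unfolding cond_cycle_def by (intro ext arg_cong[where f = mat_trace] chain_cong) auto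

text \<open>Columns of \<open>l\<close> outside \<open>l'\<close> are integrated first, the product
  over \<open>l'\<close> being free of them. The conditioned product over \<open>l\<close> then
  involves common columns only, so the columns of \<open>l'\<close> outside \<open>l\<close> can be
  integrated next.\<close>

lemma expectation_cycle_mult:
  assumes l: "set l \<subseteq> {..<k}" "distinct l" and l': "set l' \<subseteq> {..<k}" "distinct l'"
  defines "S \<equiv> set l \<inter> set l'"
  shows "expectation (\<lambda>\<omega>. cond_cycle UNIV l \<omega> * cond_cycle UNIV l' \<omega>)
    = expectation (\<lambda>\<omega>. cond_cycle S l \<omega> * cond_cycle S l' \<omega>)"
proof -
  have "expectation (\<lambda>\<omega>. cond_cycle UNIV l \<omega> * cond_cycle UNIV l' \<omega>)
      = expectation (\<lambda>\<omega>. cond_cycle ((set l - set l') \<union> S) l \<omega> * cond_cycle (set l') l' \<omega>)"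
    unfolding cond_cycle_UNIV S_def by (simp add: Int_commute Un_Diff_Int)
  also have "\<dots> = expectation (\<lambda>\<omega>. cond_cycle S l \<omega> * cond_cycle (set l') l' \<omega>)"
    using l l' by (intro expectation_cond_cycle_Un moments_cond_cycle free_col_cond_cycle) (auto simp: S_def)
  also have "\<dots> = expectation (\<lambda>\<omega>. cond_cycle ((set l' - set l) \<union> S) l' \<omega> * cond_cycle S l \<omega>)"
  proof -
    have "(set l' - set l) \<union> S = set l'" by (auto simp: S_def)
    then show ?thesis by (simp add: mult.commute)
  qed
  also have "\<dots> = expectation (\<lambda>\<omega>. cond_cycle S l' \<omega> * cond_cycle S l \<omega>)"
    using l l' by (intro expectation_cond_cycle_Un moments_cond_cycle free_col_cond_cycle) (auto simp: S_def)
  finally show ?thesis by (simp add: mult.commute)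
qed

lemma cond_cycle_disjoint: "set l \<inter> S = {} \<Longrightarrow> cond_cycle S l \<omega> = tr (length l)"
  by (simp add: cond_cycle_def chain_disjoint tr_def)

text \<open>Integrating out every column leaves a pure power of \<open>M\<close>; this makes the
  estimator unbiased.\<close>

lemma expectation_cycle:
  assumes l: "set l \<subseteq> {..<k}" "distinct l"
  shows "expectation (cond_cycle UNIV l) = tr (length l)"
proof -
  have "expectation (\<lambda>\<omega>. cond_cycle (set l \<union> {}) l \<omega> * 1) = expectation (\<lambda>\<omega>. cond_cycle {} l \<omega> * 1)"
    using l by (intro expectation_cond_cycle_Un moments_intros free_col_intros) auto
  then show ?thesis using prob_space by (simp add: cond_cycle_UNIV cond_cycle_disjoint)
qed

text \<open>Only one outer product survives, and cyclicity collects all factors \<open>M\<close>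
  between its two vectors.\<close>

lemma cond_cycle_one:
  assumes l: "distinct l" and S: "set l \<inter> S = {c}"
  shows "cond_cycle S l \<omega> = bil (length l) c c \<omega>"
proof -
  have "c \<in> set l" "c \<in> S" using S by auto
  then obtain l1 l2 where l12: "l = l1 @ c # l2" by (meson split_list)
  have d: "chain S l1 \<omega> = M ^\<^sub>m length l1" "chain S l2 \<omega> = M ^\<^sub>m length l2"
    using S l unfolding l12 by (auto intro!: chain_disjoint)
  have len: "M ^\<^sub>m length l2 * (M ^\<^sub>m length l1 * M) = M ^\<^sub>m length l"
    using M_pow_add[of "length l2" "Suc (length l1)"] unfolding l12 by (simp add: add.commute)
  have "cond_cycle S l \<omega> = mat_trace (col_outer S \<omega> c * M ^\<^sub>m length l)"
    unfolding cond_cycle_def unfolding l12 chain_append chain.simps d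
    by (subst trace_rotate) (simp_all add: M_pow_carrier len[unfolded l12])
  also have "\<dots> = bil (length l) c c \<omega>"
    using \<open>c \<in> S\<close> unfolding trace_outer[OF M_pow_carrier] bil_def
    by (auto intro!: sum.cong simp: M_pow_sym mult_ac)
  finally show ?thesis .
qed

text \<open>Two rank-one factors cut the trace into a product of two scalars, one for each arc of
  the cycle between them.\<close>

lemma trace_two_outer:
  assumes "a \<in> S" "b \<in> S"
  shows "mat_trace (col_outer S \<omega> a * (M ^\<^sub>m d * col_outer S \<omega> b * M ^\<^sub>m e)) = bil d a b \<omega> * bil e a b \<omega>"
proof -
  have R: "M ^\<^sub>m d * col_outer S \<omega> b * M ^\<^sub>m e \<in> carrier_mat n n"
    by (intro mult_carrier_n M_pow_carrier col_outer_carrier)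
  have R_entry: "(M ^\<^sub>m d * col_outer S \<omega> b * M ^\<^sub>m e) $$ (j, i)
      = (\<Sum>s<n. \<Sum>r<n. (M ^\<^sub>m d) $$ (j, r) * \<omega> (r, b) * (\<omega> (s, b) * (M ^\<^sub>m e) $$ (s, i)))"
    if "i < n" "j < n" for i j
    using that assms M_pow_carrier
    by (simp add: mat_mult_entry[of _ n n _ n] mult_carrier_n del: index_mult_mat(1))
      (simp add: col_outer_def sum_distrib_left sum_distrib_right mult_ac)
  have "mat_trace (col_outer S \<omega> a * (M ^\<^sub>m d * col_outer S \<omega> b * M ^\<^sub>m e))
      = (\<Sum>i<n. \<Sum>j<n. \<Sum>s<n. \<Sum>r<n. (\<omega> (j, a) * (M ^\<^sub>m d) $$ (j, r) * \<omega> (r, b)) * (\<omega> (s, b) * (M ^\<^sub>m e) $$ (s, i) * \<omega> (i, a)))"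
    using assms unfolding trace_outer[OF R]
    by (auto intro!: sum.cong simp: R_entry sum_distrib_left mult_ac)
  also have "\<dots> = (\<Sum>i<n. \<Sum>s<n. \<Sum>j<n. \<Sum>r<n. (\<omega> (j, a) * (M ^\<^sub>m d) $$ (j, r) * \<omega> (r, b)) * (\<omega> (s, b) * (M ^\<^sub>m e) $$ (s, i) * \<omega> (i, a)))"
    by (rule sum.cong[OF refl], rule sum.swap)
  also have "\<dots> = (\<Sum>i<n. \<Sum>s<n. bil d a b \<omega> * (\<omega> (s, b) * (M ^\<^sub>m e) $$ (s, i) * \<omega> (i, a)))"
    unfolding bil_def by (simp only: sum_distrib_right)
  also have "\<dots> = bil d a b \<omega> * bil e b a \<omega>"
    unfolding bil_def[of e] by (subst sum.swap) (simp only: sum_distrib_left)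
  finally show ?thesis by (simp add: bil_sym[of e])
qed

text \<open>\<open>d\<close> and \<open>e\<close> count the factors \<open>M\<close> on the two arcs
  between the columns \<open>a\<close> and \<open>b\<close>. Each is at least 1 since every outer
  product is preceded by its own \<open>M\<close>.\<close>

lemma cond_cycle_two:
  assumes l: "distinct l" and S: "set l \<inter> S = {a, b}" "a \<noteq> b"
  shows "\<exists>d\<ge>1. \<exists>e\<ge>1. d + e = length l \<and> (\<forall>\<omega>. cond_cycle S l \<omega> = bil d a b \<omega> * bil e a b \<omega>)"
proof -
  \<comment> \<open>The case where \<open>x\<close> comes first in the list; the other order follows
    from \<open>bil_sym\<close>. The inner arc has length \<open>Suc (length l2)\<close>, the outer
    one wraps around the end of the list.\<close>
  have ordered: "\<exists>d\<ge>1. \<exists>e\<ge>1. d + e = length l \<and> (\<forall>\<omega>. cond_cycle S l \<omega> = bil d x y \<omega> * bil e x y \<omega>)"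
    if xy: "set l \<inter> S = {x, y}" "x \<noteq> y" and l123: "l = l1 @ x # l2 @ y # l3" for x y l1 l2 l3
  proof (intro exI conjI allI)
    fix \<omega>
    have inS: "x \<in> S" "y \<in> S" using xy by auto
    have d: "chain S l1 \<omega> = M ^\<^sub>m length l1" "chain S l2 \<omega> = M ^\<^sub>m length l2" "chain S l3 \<omega> = M ^\<^sub>m length l3"
      using xy l unfolding l123 by (auto intro!: chain_disjoint)
    let ?W = "col_outer S \<omega>"
    have "cond_cycle S l \<omega> = mat_trace (M ^\<^sub>m length l1 * (M * ?W x * (M ^\<^sub>m length l2 * (M * ?W y * M ^\<^sub>m length l3))))"
      unfolding cond_cycle_def l123 by (simp add: chain_append d)
    also have "\<dots> = mat_trace (?W x * ((M ^\<^sub>m length l2 * (M * ?W y * M ^\<^sub>m length l3)) * (M ^\<^sub>m length l1 * M)))"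
      by (intro trace_rotate mult_carrier_n M_pow_carrier M_carrier col_outer_carrier)
    also have "(M ^\<^sub>m length l2 * (M * ?W y * M ^\<^sub>m length l3)) * (M ^\<^sub>m length l1 * M)
        = M ^\<^sub>m Suc (length l2) * ?W y * M ^\<^sub>m (length l3 + Suc (length l1))"
      unfolding M_pow_add[of "length l3"] pow_mat.simps
      using M_pow_carrier M_carrier by (simp add: assoc_mult_mat[of _ n n _ n _ n] mult_carrier_n)
    also have "mat_trace (?W x * \<dots>) = bil (Suc (length l2)) x y \<omega> * bil (length l3 + Suc (length l1)) x y \<omega>"
      by (rule trace_two_outer[OF inS])
    finally show "cond_cycle S l \<omega> = bil (Suc (length l2)) x y \<omega> * bil (length l3 + Suc (length l1)) x y \<omega>" .
  qed (auto simp: l123)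
  have "a \<in> set l" "b \<in> set l" using S by auto
  then obtain l1 l2 where l12: "l = l1 @ a # l2" by (meson split_list)
  with \<open>b \<in> set l\<close> S(2) consider "b \<in> set l2" | "b \<in> set l1" by auto
  then show ?thesis
  proof cases
    case 1
    then obtain l3 l4 where "l2 = l3 @ b # l4" by (meson split_list)
    then show ?thesis using ordered[OF S, of l1 l3 l4] l12 by simp
  next
    case 2
    then obtain l3 l4 where "l1 = l3 @ b # l4" by (meson split_list)
    then show ?thesis using ordered[of b a l3 l4 l2] S l12
      by (simp add: insert_commute bil_sym[of _ b a])
  qed
qed

section \<open>A second-moment bound by Cauchy-Schwarz\<close>

text \<open>With all outer products present the chain has rank at most one: adjacent vectors join
  into Gram entries, leaving \<open>M\<close> times the first column on the left and the last column
  on the right.\<close>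

lemma chain_UNIV_entry:
  assumes "a < n" "b < n"
  shows "chain UNIV (c # l) \<omega> $$ (a, b)
    = (\<Sum>e<n. M $$ (a, e) * \<omega> (e, c)) * path_prod (\<lambda>i j. bil 1 i j \<omega>) (c # l) * \<omega> (b, last (c # l))"
  using assms
proof (induction l arbitrary: a c)
  case Nil
  then show ?case
    unfolding chain_Cons_entry[OF Nil.prems]
    by (simp add: col_outer_def sum_distrib_right mult.assoc of_bool_def if_distrib[of "\<lambda>x. _ * x"] cong: if_cong)
next
  case (Cons c' l)
  define v where "v a c = (\<Sum>e<n. M $$ (a, e) * \<omega> (e, c))" for a c
  let ?p = "path_prod (\<lambda>i j. bil 1 i j \<omega>) (c' # l) * \<omega> (b, last (c' # l))"
  have outer: "(\<Sum>e<n. M $$ (a, e) * col_outer UNIV \<omega> c $$ (e, d)) = v a c * \<omega> (d, c)" if "d < n" for d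
    using that by (simp add: v_def col_outer_def sum_distrib_right mult.assoc)
  have "chain UNIV (c # c' # l) \<omega> $$ (a, b)
      = (\<Sum>d<n. v a c * \<omega> (d, c) * chain UNIV (c' # l) \<omega> $$ (d, b))"
    unfolding chain_Cons_entry[OF Cons.prems] by (intro sum.cong refl) (simp only: outer lessThan_iff)
  also have "\<dots> = (\<Sum>d<n. v a c * (\<omega> (d, c) * v d c') * ?p)"
    using Cons.IH[of _ c'] Cons.prems by (intro sum.cong refl) (simp only: v_def lessThan_iff mult.assoc)
  also have "\<dots> = v a c * (\<Sum>d<n. \<omega> (d, c) * v d c') * ?p"
    by (simp only: sum_distrib_left sum_distrib_right)
  also have "(\<Sum>d<n. \<omega> (d, c) * v d c') = bil 1 c c' \<omega>"
    unfolding bil_def M_pow_1[unfolded One_nat_def[symmetric]] v_def by (simp only: sum_distrib_left mult.assoc)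
  finally show ?case by (simp add: v_def mult.assoc)
qed

lemma cond_cycle_eq_cycle_prod:
  assumes "l \<noteq> []"
  shows "cond_cycle UNIV l \<omega> = cycle_prod (\<lambda>i j. bil 1 i j \<omega>) l"
proof -
  obtain c l' where l: "l = c # l'" using assms by (cases l) auto
  let ?p = "path_prod (\<lambda>i j. bil 1 i j \<omega>) l"
  have "cond_cycle UNIV l \<omega> = (\<Sum>a<n. (\<Sum>e<n. \<omega> (a, last l) * M $$ (a, e) * \<omega> (e, c)) * ?p)"
    unfolding cond_cycle_eq l
    by (intro sum.cong refl, subst chain_UNIV_entry) (auto simp: sum_distrib_left mult_ac)
  also have "\<dots> = bil 1 (last l) c \<omega> * ?p"
    unfolding bil_def M_pow_1[unfolded One_nat_def[symmetric]] by (simp only: sum_distrib_right)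
  finally show ?thesis by (simp add: cycle_prod_def l mult.commute)
qed

text \<open>This exhibits \<open>bil 1 i j\<close> as the inner product of the images under
  \<open>A\<close> of columns \<open>i\<close> and \<open>j\<close>, whence nonnegativity on the
  diagonal and Cauchy-Schwarz.\<close>

lemma bil_1_eq: "bil 1 i j \<omega> = (\<Sum>r<m. (\<Sum>a<n. A $$ (r, a) * \<omega> (a, i)) * (\<Sum>b<n. A $$ (r, b) * \<omega> (b, j)))"
proof -
  have "bil 1 i j \<omega> = (\<Sum>a<n. \<Sum>b<n. \<Sum>r<m. (A $$ (r, a) * \<omega> (a, i)) * (A $$ (r, b) * \<omega> (b, j)))"
    unfolding bil_def M_pow_1[unfolded One_nat_def[symmetric]]
    by (intro sum.cong refl) (simp add: M_entry sum_distrib_left sum_distrib_right mult_ac)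
  also have "\<dots> = (\<Sum>a<n. \<Sum>r<m. \<Sum>b<n. (A $$ (r, a) * \<omega> (a, i)) * (A $$ (r, b) * \<omega> (b, j)))"
    by (rule sum.cong[OF refl], rule sum.swap)
  also have "\<dots> = (\<Sum>r<m. \<Sum>a<n. \<Sum>b<n. (A $$ (r, a) * \<omega> (a, i)) * (A $$ (r, b) * \<omega> (b, j)))"
    by (rule sum.swap)
  finally show ?thesis by (simp add: sum_product)
qed

lemma bil_1_nonneg: "bil 1 i i \<omega> \<ge> 0"
  unfolding bil_1_eq by (intro sum_nonneg) simp

lemma bil_1_Cauchy_Schwarz: "(bil 1 i j \<omega>)\<^sup>2 \<le> bil 1 i i \<omega> * bil 1 j j \<omega>"
  unfolding bil_1_eq using Cauchy_Schwarz_ineq_sum[of "\<lambda>r. \<Sum>a<n. A $$ (r, a) * \<omega> (a, i)"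
    "\<lambda>r. \<Sum>b<n. A $$ (r, b) * \<omega> (b, j)" "{..<m}"] by (simp add: power2_eq_square)

text \<open>Cauchy-Schwarz on each edge: an interior vertex lies on two edges and gets a squared
  diagonal entry, an end vertex lies on one. The extra factor on the left completes the square at
  the last vertex, which makes the induction close; the closing edge of a cycle later supplies what
  both ends lack.\<close>

lemma path_prod_square_le:
  "(path_prod (\<lambda>i j. bil 1 i j \<omega>) (c # l))\<^sup>2 * bil 1 (last (c # l)) (last (c # l)) \<omega>
    \<le> bil 1 c c \<omega> * (\<Prod>x\<leftarrow>l. (bil 1 x x \<omega>)\<^sup>2)"
proof (induction l arbitrary: c)
  case (Cons c' l)
  let ?Z = "\<lambda>i j. bil 1 i j \<omega>" and ?e = "last (c' # l)"
  have "(path_prod ?Z (c # c' # l))\<^sup>2 * ?Z ?e ?e = (?Z c c')\<^sup>2 * ((path_prod ?Z (c' # l))\<^sup>2 * ?Z ?e ?e)"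
    by (simp add: power_mult_distrib)
  also have "\<dots> \<le> (?Z c c * ?Z c' c') * (?Z c' c' * (\<Prod>x\<leftarrow>l. (?Z x x)\<^sup>2))"
    by (intro mult_mono bil_1_Cauchy_Schwarz Cons.IH mult_nonneg_nonneg bil_1_nonneg) auto
  finally show ?case by (simp add: power2_eq_square mult_ac)
qed simp

lemma cycle_square_le:
  assumes "l \<noteq> []"
  shows "(cond_cycle UNIV l \<omega>)\<^sup>2 \<le> (\<Prod>x\<leftarrow>l. (bil 1 x x \<omega>)\<^sup>2)"
proof -
  obtain c l' where l: "l = c # l'" using assms by (cases l) auto
  let ?Z = "\<lambda>i j. bil 1 i j \<omega>" and ?e = "last l"
  have "(cond_cycle UNIV l \<omega>)\<^sup>2 = (path_prod ?Z l)\<^sup>2 * (?Z ?e c)\<^sup>2"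
    unfolding cond_cycle_eq_cycle_prod[OF assms] by (simp add: cycle_prod_def l power_mult_distrib)
  also have "\<dots> \<le> (path_prod ?Z l)\<^sup>2 * (?Z ?e ?e * ?Z c c)"
    by (intro mult_left_mono bil_1_Cauchy_Schwarz) auto
  also have "\<dots> = ((path_prod ?Z l)\<^sup>2 * ?Z ?e ?e) * ?Z c c" by simp
  also have "\<dots> \<le> (?Z c c * (\<Prod>x\<leftarrow>l'. (?Z x x)\<^sup>2)) * ?Z c c"
    unfolding l by (intro mult_right_mono path_prod_square_le bil_1_nonneg)
  finally show ?thesis by (simp add: l power2_eq_square mult_ac)
qed

text \<open>Each column contributes the second moment of \<open>bil 1 x x\<close>. The three claims
  are proved together because splitting off one column uses the moments of the remaining product and
  its freedom from that column.\<close>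

lemma expectation_prod_bil_square:
  assumes "set l \<subseteq> {..<k}" "distinct l"
  shows "moments (\<lambda>\<omega>. \<Prod>x\<leftarrow>l. (bil 1 x x \<omega>)\<^sup>2)
    \<and> expectation (\<lambda>\<omega>. \<Prod>x\<leftarrow>l. (bil 1 x x \<omega>)\<^sup>2) = ((tr 1)\<^sup>2 + 2 * tr 2) ^ length l
    \<and> (\<forall>c. c \<notin> set l \<longrightarrow> free_col c (\<lambda>\<omega>. \<Prod>x\<leftarrow>l. (bil 1 x x \<omega>)\<^sup>2))"
  using assms
proof (induction l)
  case Nil
  then show ?case using prob_space by (simp add: all_moments_const[OF finite_measure_P] free_col_intros)
next
  case (Cons c l)
  let ?H = "\<lambda>\<omega>. \<Prod>x\<leftarrow>l. (bil 1 x x \<omega>)\<^sup>2"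
  have IH: "moments ?H" "expectation ?H = ((tr 1)\<^sup>2 + 2 * tr 2) ^ length l"
    "\<And>c. c \<notin> set l \<Longrightarrow> free_col c ?H"
    using Cons by auto
  have c: "c < k" "c \<notin> set l" using Cons.prems by auto
  have eq: "(\<lambda>\<omega>. \<Prod>x\<leftarrow>c # l. (bil 1 x x \<omega>)\<^sup>2) = (\<lambda>\<omega>. bil 1 c c \<omega> * bil 1 c c \<omega> * ?H \<omega>)"
    by (simp add: power2_eq_square mult.assoc)
  have "expectation (\<lambda>\<omega>. bil 1 c c \<omega> * bil 1 c c \<omega> * ?H \<omega>) = (tr 1 * tr 1 + 2 * tr (1 + 1)) * expectation ?H"
    by (intro expectation_bil_square_times c IH)
  moreover have "moments (\<lambda>\<omega>. bil 1 c c \<omega> * bil 1 c c \<omega> * ?H \<omega>)"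
    by (intro all_moments_mult moments_bil c IH)
  moreover have "free_col d (\<lambda>\<omega>. bil 1 c c \<omega> * bil 1 c c \<omega> * ?H \<omega>)" if "d \<notin> set (c # l)" for d
    using that by (intro free_col_intros free_col_bil IH(3)) auto
  ultimately show ?case unfolding eq IH(2) by (simp add: power2_eq_square numeral_2_eq_2[symmetric])
qed

text \<open>By \<open>2 * x * y \<le> x^2 + y^2\<close> and the pointwise bound on the squares, both
  of which have the same mean. The bound does not depend on \<open>k\<close>, as a third-order term
  requires.\<close>

lemma expectation_cycle_mult_le:
  assumes l: "set l \<subseteq> {..<k}" "distinct l" "length l = p" and l': "set l' \<subseteq> {..<k}" "distinct l'" "length l' = p"
    and p: "p \<ge> 1"
  shows "expectation (\<lambda>\<omega>. cond_cycle UNIV l \<omega> * cond_cycle UNIV l' \<omega>) \<le> ((tr 1)\<^sup>2 + 2 * tr 2) ^ p"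
proof -
  let ?B = "\<lambda>l \<omega>. \<Prod>x\<leftarrow>l. (bil 1 x x \<omega>)\<^sup>2"
  have ne: "l \<noteq> []" "l' \<noteq> []" using assms by auto
  have i: "integrable P (\<lambda>\<omega>. cond_cycle UNIV l \<omega> * cond_cycle UNIV l' \<omega>)"
    by (intro all_moments_integrable all_moments_mult moments_cond_cycle l l')
  have iB: "integrable P (?B l)" "integrable P (?B l')"
    using expectation_prod_bil_square l l' by (auto intro: all_moments_integrable)
  have "expectation (\<lambda>\<omega>. cond_cycle UNIV l \<omega> * cond_cycle UNIV l' \<omega>) \<le> expectation (\<lambda>\<omega>. (?B l \<omega> + ?B l' \<omega>) / 2)"
  proof (rule integral_mono)
    fix \<omega>
    have "2 * (cond_cycle UNIV l \<omega> * cond_cycle UNIV l' \<omega>) \<le> ?B l \<omega> + ?B l' \<omega>"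
      unfolding mult.assoc[symmetric] using cycle_square_le[OF ne(1), of \<omega>] cycle_square_le[OF ne(2), of \<omega>]
        sum_squares_bound[of "cond_cycle UNIV l \<omega>" "cond_cycle UNIV l' \<omega>"] by linarith
    then show "cond_cycle UNIV l \<omega> * cond_cycle UNIV l' \<omega> \<le> (?B l \<omega> + ?B l' \<omega>) / 2" by simp
  qed (use i iB in auto)
  also have "\<dots> = ((tr 1)\<^sup>2 + 2 * tr 2) ^ p"
    using expectation_prod_bil_square[OF l(1,2)] expectation_prod_bil_square[OF l'(1,2)] iB l l' by simp
  finally show ?thesis .
qed

section \<open>The variance of the estimator\<close>

definition gram_cycle :: "nat set \<Rightarrow> (nat \<times> nat \<Rightarrow> real) \<Rightarrow> real" where
  "gram_cycle I = cond_cycle UNIV (sorted_list_of_set I)"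

lemma sketch_gram_carrier: "sketch_gram A (mat n k \<omega>) \<in> carrier_mat k k"
  by (intro carrier_matI) (simp_all add: sketch_gram_def)

lemma sketch_gram_entry:
  assumes "i < k" "j < k"
  shows "sketch_gram A (mat n k \<omega>) $$ (i, j) = bil 1 i j \<omega>"
proof -
  have AW: "A * mat n k \<omega> \<in> carrier_mat m k" using A by simp
  have e: "(A * mat n k \<omega>) $$ (r, c) = (\<Sum>a<n. A $$ (r, a) * \<omega> (a, c))" if "r < m" "c < k" for r c
    using A that by (simp add: mat_mult_entry[of _ m n _ k] del: index_mult_mat(1))
  show ?thesis
    unfolding bil_1_eq sketch_gram_def using assms AW A
    by (simp add: mat_mult_entry[of _ k m _ k] e del: index_mult_mat(1))
qed

lemma estimator_eq:
  assumes "p \<ge> 1"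
  shows "schatten_estimator p A (mat n k \<omega>)
    = (\<Sum>I\<in>subsets_of_card k p. gram_cycle I \<omega>) / real (k choose p)"
proof -
  have "cycle_prod (\<lambda>i j. sketch_gram A (mat n k \<omega>) $$ (i, j)) (sorted_list_of_set I) = gram_cycle I \<omega>"
    if I: "I \<in> subsets_of_card k p" for I
  proof -
    have ne: "sorted_list_of_set I \<noteq> []" using subset_list[OF I] assms by auto
    show ?thesis
      unfolding gram_cycle_def cond_cycle_eq_cycle_prod[OF ne]
      using subset_list[OF I] ne by (intro cycle_prod_cong sketch_gram_entry) auto
  qed
  then show ?thesis
    unfolding schatten_estimator_def trace_strict_upper_pow[OF sketch_gram_carrier assms] by simp
qed

lemma moments_gram_cycle: "I \<in> subsets_of_card k p \<Longrightarrow> moments (gram_cycle I)"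
  unfolding gram_cycle_def using subset_list by (intro moments_cond_cycle) auto

text \<open>Every cyclic product has mean \<open>tr p\<close>, so the squared mean of the sum
  distributes over the pairs \<open>I\<close>, \<open>J\<close> and each summand is a
  covariance.\<close>

lemma estimator_variance_eq:
  assumes "p \<ge> 1" "p \<le> k"
  shows "estimator_variance p A k
    = (\<Sum>I\<in>subsets_of_card k p. \<Sum>J\<in>subsets_of_card k p.
        expectation (\<lambda>\<omega>. gram_cycle I \<omega> * gram_cycle J \<omega>) - (tr p)\<^sup>2) / (real (k choose p))\<^sup>2"
proof -
  let ?P = "subsets_of_card k p" and ?N = "real (k choose p)"
  define X where "X \<omega> = (\<Sum>I\<in>?P. gram_cycle I \<omega>)" for \<omega>
  have X: "moments X" unfolding X_def by (intro moments_intros moments_gram_cycle)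
  have N: "?N > 0" using assms by simp
  have EX: "expectation X = ?N * tr p"
  proof -
    have "expectation X = (\<Sum>I\<in>?P. expectation (gram_cycle I))"
      unfolding X_def by (intro expectation_sum moments_gram_cycle)
    also have "\<dots> = (\<Sum>I\<in>?P. tr p)"
      unfolding gram_cycle_def using subset_list by (intro sum.cong refl) (simp add: expectation_cycle)
    finally show ?thesis by (simp add: card_subsets_of_card)
  qed
  have EX2: "expectation (\<lambda>\<omega>. (X \<omega>)\<^sup>2) = (\<Sum>I\<in>?P. \<Sum>J\<in>?P. expectation (\<lambda>\<omega>. gram_cycle I \<omega> * gram_cycle J \<omega>))"
  proof -
    have "expectation (\<lambda>\<omega>. (X \<omega>)\<^sup>2) = expectation (\<lambda>\<omega>. \<Sum>I\<in>?P. \<Sum>J\<in>?P. gram_cycle I \<omega> * gram_cycle J \<omega>)"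
      unfolding X_def power2_eq_square sum_product ..
    also have "\<dots> = (\<Sum>I\<in>?P. expectation (\<lambda>\<omega>. \<Sum>J\<in>?P. gram_cycle I \<omega> * gram_cycle J \<omega>))"
      by (intro expectation_sum moments_intros moments_gram_cycle)
    also have "\<dots> = (\<Sum>I\<in>?P. \<Sum>J\<in>?P. expectation (\<lambda>\<omega>. gram_cycle I \<omega> * gram_cycle J \<omega>))"
      by (intro sum.cong refl expectation_sum moments_intros moments_gram_cycle)
    finally show ?thesis .
  qed
  have "estimator_variance p A k = variance (\<lambda>\<omega>. X \<omega> / ?N)"
    using A unfolding estimator_variance_def estimator_eq[OF assms(1)] X_def
    by (simp add: estimator_eq[OF assms(1)])
  also have "\<dots> = expectation (\<lambda>\<omega>. (X \<omega> / ?N)\<^sup>2) - (expectation (\<lambda>\<omega>. X \<omega> / ?N))\<^sup>2"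
  proof (intro variance_eq all_moments_integrable)
    show m: "moments (\<lambda>\<omega>. X \<omega> / ?N)"
      using all_moments_mult[OF X all_moments_const[OF finite_measure_P, of "1 / ?N"]] by simp
    show "moments (\<lambda>\<omega>. (X \<omega> / ?N)\<^sup>2)"
      by (intro all_moments_power[OF finite_measure_P] m)
  qed
  also have "\<dots> = (expectation (\<lambda>\<omega>. (X \<omega>)\<^sup>2) - (?N * tr p)\<^sup>2) / ?N\<^sup>2"
    by (simp only: power_divide integral_divide_zero EX diff_divide_distrib)
  also have "(?N * tr p)\<^sup>2 = (\<Sum>I\<in>?P. \<Sum>J\<in>?P. (tr p)\<^sup>2)"
    by (simp add: card_subsets_of_card power_mult_distrib) (simp add: power2_eq_square mult.assoc)
  finally show ?thesis
    by (simp only: EX2 sum_subtractf)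
qed

lemma tr_power_sum: "q \<ge> 1 \<Longrightarrow> tr q = power_sum q (singular_values A)"
  by (simp add: tr_def M_def power_sum_singular_values[OF A])

text \<open>Conditioned on the common columns, each cyclic product is a constant, a quadratic form,
  or a product of two bilinear forms when there are 0, 1 or 2 of them. In the last case the pairing
  within each cycle gives \<open>(tr p)\<^sup>2\<close>, which cancels, and the two cross pairings
  remain.\<close>

lemma covariance_bounds:
  assumes p: "p \<ge> 1" and I: "I \<in> subsets_of_card k p" and J: "J \<in> subsets_of_card k p"
  defines "cov \<equiv> expectation (\<lambda>\<omega>. gram_cycle I \<omega> * gram_cycle J \<omega>) - (tr p)\<^sup>2"
  shows "card (I \<inter> J) = 0 \<Longrightarrow> cov \<le> 0"
    and "card (I \<inter> J) = 1 \<Longrightarrow> cov \<le> 2 * tr (2 * p)"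
    and "card (I \<inter> J) = 2 \<Longrightarrow> cov \<le> 6 * tr (2 * p) + 2 * (tr 2 * tr (2 * p - 2))"
    and "cov \<le> ((tr 1)\<^sup>2 + 2 * tr 2) ^ p"
proof -
  let ?l = "sorted_list_of_set I" and ?l' = "sorted_list_of_set J"
  note l = subset_list[OF I] and l' = subset_list[OF J]
  have fin: "finite (I \<inter> J)" using l(2) by (auto intro: finite_subset[of _ "{..<k}"])
  have inter: "set ?l \<inter> (I \<inter> J) = I \<inter> J" "set ?l' \<inter> (I \<inter> J) = I \<inter> J"
    using l l' by auto
  have E: "expectation (\<lambda>\<omega>. gram_cycle I \<omega> * gram_cycle J \<omega>)
      = expectation (\<lambda>\<omega>. cond_cycle (I \<inter> J) ?l \<omega> * cond_cycle (I \<inter> J) ?l' \<omega>)"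
    unfolding gram_cycle_def using l l' by (subst expectation_cycle_mult) auto
  show "cov \<le> ((tr 1)\<^sup>2 + 2 * tr 2) ^ p"
  proof -
    have "expectation (\<lambda>\<omega>. gram_cycle I \<omega> * gram_cycle J \<omega>) \<le> ((tr 1)\<^sup>2 + 2 * tr 2) ^ p"
      unfolding gram_cycle_def using l l' p by (intro expectation_cycle_mult_le) auto
    then show ?thesis unfolding cov_def using zero_le_power2[of "tr p"] by linarith
  qed
  show "cov \<le> 0" if "card (I \<inter> J) = 0"
  proof -
    have "I \<inter> J = {}" using that fin by simp
    then show ?thesis unfolding cov_def E
      using l l' prob_space by (simp add: cond_cycle_disjoint power2_eq_square)
  qed
  show "cov \<le> 2 * tr (2 * p)" if "card (I \<inter> J) = 1"
  proof -
    obtain c where c: "I \<inter> J = {c}" using \<open>card (I \<inter> J) = 1\<close> by (auto simp: card_1_singleton_iff)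
    have "cond_cycle (I \<inter> J) ?l \<omega> = bil p c c \<omega>" "cond_cycle (I \<inter> J) ?l' \<omega> = bil p c c \<omega>" for \<omega>
      using cond_cycle_one[OF _ trans[OF inter(1) c], of \<omega>] cond_cycle_one[OF _ trans[OF inter(2) c], of \<omega>] l(3) l'(3)
      by simp_all
    moreover have "c < k" using c l(2) by auto
    ultimately have "expectation (\<lambda>\<omega>. gram_cycle I \<omega> * gram_cycle J \<omega>) = tr p * tr p + 2 * tr (p + p)"
      unfolding E by (simp only: expectation_bil_square)
    then show ?thesis unfolding cov_def by (simp only: power2_eq_square mult_2[of p])
  qed
  show "cov \<le> 6 * tr (2 * p) + 2 * (tr 2 * tr (2 * p - 2))" if "card (I \<inter> J) = 2"
  proof -
    obtain a b where ab: "I \<inter> J = {a, b}" "a \<noteq> b" using \<open>card (I \<inter> J) = 2\<close> by (auto simp: card_2_iff)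
    have k: "a < k" "b < k" using ab l(2) by auto
    obtain d e where de: "d \<ge> 1" "e \<ge> 1" "d + e = p"
      "\<And>\<omega>. cond_cycle (I \<inter> J) ?l \<omega> = bil d a b \<omega> * bil e a b \<omega>"
      using cond_cycle_two[OF _ trans[OF inter(1) ab(1)] ab(2)] l(3) by auto
    obtain d' e' where de': "d' \<ge> 1" "e' \<ge> 1" "d' + e' = p"
      "\<And>\<omega>. cond_cycle (I \<inter> J) ?l' \<omega> = bil d' a b \<omega> * bil e' a b \<omega>"
      using cond_cycle_two[OF _ trans[OF inter(2) ab(1)] ab(2)] l'(3) by auto
    \<comment> \<open>Each index is a sum of two arc lengths, one from each cycle, hence at least
      2.\<close>
    have "tr x * tr y \<le> tr 2 * tr (2 * p - 2)" if "x \<ge> 2" "y \<ge> 2" "x + y = 2 * p" for x y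
      using power_sum_mult_le[OF that(1,2), of "singular_values A"] that by (simp add: tr_power_sum)
    from this[of "d + d'" "e + e'"] this[of "d + e'" "e + d'"]
    have "tr (d + d') * tr (e + e') + tr (d + e') * tr (e + d') \<le> 2 * (tr 2 * tr (2 * p - 2))"
      using de(1-3) de'(1-3) by linarith
    moreover have "expectation (\<lambda>\<omega>. gram_cycle I \<omega> * gram_cycle J \<omega>)
        = (tr p)\<^sup>2 + tr (d + d') * tr (e + e') + tr (d + e') * tr (e + d') + 6 * tr (2 * p)"
    proof -
      have "d + e + d' + e' = 2 * p" using de(3) de'(3) by linarith
      then show ?thesis
        unfolding E de(4) de'(4) expectation_bil_quartic[OF k ab(2)]
        by (simp only: de(3) de'(3) power2_eq_square)
    qed
    ultimately show ?thesis unfolding cov_def by linarith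
  qed
qed

lemma variance_bound:
  assumes p: "p \<ge> 1" and k: "k \<ge> 3" "p \<le> k"
  shows "estimator_variance p A k \<le> 2 * tr (2 * p) * (real p)\<^sup>2 / real k
    + (tr (2 * p) + tr 2 * tr (2 * p - 2)) * ((real p)\<^sup>2 * (real p - 1)\<^sup>2) / (real k)\<^sup>2
    + (2 * (tr (2 * p) + tr 2 * tr (2 * p - 2)) * ((real p)\<^sup>2 * (real p - 1)\<^sup>2)
        + 36 * ((tr 1)\<^sup>2 + 2 * tr 2) ^ p * (real (p choose 3))\<^sup>2) / (real k) ^ 3"
proof -
  \<comment> \<open>The index 0 occurs at \<open>p = 1\<close>, where \<open>tr (2 * p - 2)\<close>
    is the trace of the identity.\<close>
  have nn: "tr q \<ge> 0" for q
  proof (cases "q \<ge> 1")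
    case True
    then show ?thesis by (simp add: tr_power_sum power_sum_nonneg)
  next
    case False
    then have "q = 0" by simp
    then show ?thesis using M_carrier by (simp add: tr_eq)
  qed
  show ?thesis
    unfolding estimator_variance_eq[OF p k(2)]
    using covariance_bounds[OF p] nn
    by (intro hypergeometric_sum_bound[OF k p]) (auto intro!: mult_nonneg_nonneg zero_le_power add_nonneg_nonneg)
qed

end

text \<open>\<open>C\<close> is chosen before the dimensions and the matrix and sees only the
  multiset of singular values; this expresses that the constant is a symmetric function of them. The
  bound is established for all \<open>k\<close> from \<open>max 3 p\<close> on.\<close>

theorem corollary4:
  fixes p :: nat
  assumes "p \<ge> 1"
  shows "\<exists>C :: real multiset \<Rightarrow> real.
    \<forall>m n. \<forall>A \<in> carrier_mat m n. \<forall>\<^sub>F k in sequentially.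
      estimator_variance p A k
        \<le> 2 * real p ^ 2 * schatten_norm (4 * p) A ^ (4 * p) / real k
          + real p ^ 2 * (real p - 1) ^ 2 / real k ^ 2
              * (schatten_norm (4 * p) A ^ (4 * p)
                 + 3 / 2 * schatten_norm 4 A ^ 4 * schatten_norm (4 * p - 4) A ^ (4 * p - 4)
                 - 1 / 2 * schatten_norm (2 * p) A ^ (4 * p))
          + C (singular_values A) / real k ^ 3"
proof -
  define B where "B S = power_sum (2 * p) S + power_sum 2 S * power_sum (2 * p - 2) S" for S
  \<comment> \<open>The third-order coefficient of \<open>variance_bound\<close> in terms of power
    sums.\<close>
  define C where "C S = 2 * B S * ((real p)\<^sup>2 * (real p - 1)\<^sup>2)
    + 36 * ((power_sum 1 S)\<^sup>2 + 2 * power_sum 2 S) ^ p * (real (p choose 3))\<^sup>2" for S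
  show ?thesis
  proof (intro exI[of _ C] allI ballI)
    fix m n :: nat and A :: "real mat"
    assume A: "A \<in> carrier_mat m n"
    let ?s = "\<lambda>q. power_sum q (singular_values A)"
    have "x ^ (4 * p) = (x ^ (2 * p))\<^sup>2" for x :: real
      by (simp add: power_mult[symmetric])
    then have norms: "schatten_norm (4 * p) A ^ (4 * p) = ?s (2 * p)" "schatten_norm 4 A ^ 4 = ?s 2"
      "schatten_norm (2 * p) A ^ (4 * p) = (?s p)\<^sup>2"
      using schatten_norm_pow[of "2 * p" A] schatten_norm_pow[of 2 A] schatten_norm_pow[of p A] assms
      by (simp_all flip: mult.assoc)
    \<comment> \<open>The right bracket exceeds \<open>B\<close> by half of
      \<open>?s 2 * ?s (2 * p - 2) - (?s p)\<^sup>2\<close>, which is nonnegative. At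
      \<open>p = 1\<close> both sides vanish with \<open>(real p - 1)\<^sup>2\<close>, so the
      degenerate \<open>schatten_norm 0 A\<close> has no effect.\<close>
    have second: "(real p)\<^sup>2 * (real p - 1)\<^sup>2 * B (singular_values A) \<le> (real p)\<^sup>2 * (real p - 1)\<^sup>2
        * (?s (2 * p) + 3 / 2 * ?s 2 * schatten_norm (4 * p - 4) A ^ (4 * p - 4) - 1 / 2 * (?s p)\<^sup>2)"
    proof (cases "p = 1")
      case False
      then have p: "p \<ge> 2" using assms by simp
      then have "schatten_norm (4 * p - 4) A ^ (4 * p - 4) = ?s (2 * p - 2)"
        using schatten_norm_pow[of "2 * p - 2" A] by (simp add: right_diff_distrib')
      moreover have "(?s p)\<^sup>2 \<le> ?s 2 * ?s (2 * p - 2)"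
        using power_sum_mult_le[OF p p, of "singular_values A"] by (simp add: power2_eq_square mult_2)
      ultimately show ?thesis by (intro mult_left_mono) (auto simp: B_def)
    qed simp
    show "\<forall>\<^sub>F k in sequentially. estimator_variance p A k
        \<le> 2 * real p ^ 2 * schatten_norm (4 * p) A ^ (4 * p) / real k
          + real p ^ 2 * (real p - 1) ^ 2 / real k ^ 2
              * (schatten_norm (4 * p) A ^ (4 * p)
                 + 3 / 2 * schatten_norm 4 A ^ 4 * schatten_norm (4 * p - 4) A ^ (4 * p - 4)
                 - 1 / 2 * schatten_norm (2 * p) A ^ (4 * p))
          + C (singular_values A) / real k ^ 3"
      using eventually_ge_at_top[of "max 3 p"]
    proof eventually_elim
      case (elim k)
      interpret gaussian_sketch n k A m by unfold_locales (rule A)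
      \<comment> \<open>The factor \<open>(real p - 1)\<^sup>2\<close> is kept because at
        \<open>p = 1\<close> the trace \<open>tr 0\<close> is \<open>n\<close> but the power sum of
        order 0 is \<open>min m n\<close>.\<close>
      have tr: "tr (2 * p) = ?s (2 * p)" "tr 2 * tr (2 * p - 2) * (real p - 1)\<^sup>2 = ?s 2 * ?s (2 * p - 2) * (real p - 1)\<^sup>2"
        "tr 1 = ?s 1" "tr 2 = ?s 2"
        using assms by (cases "p = 1"; simp add: tr_power_sum)+
      have B: "(tr (2 * p) + tr 2 * tr (2 * p - 2)) * ((real p)\<^sup>2 * (real p - 1)\<^sup>2)
          = (real p)\<^sup>2 * (real p - 1)\<^sup>2 * B (singular_values A)"
        using tr(1,2) by (simp add: B_def algebra_simps)
      have "2 * (tr (2 * p) + tr 2 * tr (2 * p - 2)) * ((real p)\<^sup>2 * (real p - 1)\<^sup>2)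
          = 2 * ((real p)\<^sup>2 * (real p - 1)\<^sup>2 * B (singular_values A))"
        unfolding mult.assoc[of 2] B ..
      then have C: "2 * (tr (2 * p) + tr 2 * tr (2 * p - 2)) * ((real p)\<^sup>2 * (real p - 1)\<^sup>2)
          + 36 * ((tr 1)\<^sup>2 + 2 * tr 2) ^ p * (real (p choose 3))\<^sup>2 = C (singular_values A)"
        unfolding C_def tr(3) tr(4)[symmetric] by (simp only: mult_ac)
      have "estimator_variance p A k \<le> 2 * tr (2 * p) * (real p)\<^sup>2 / real k
          + (real p)\<^sup>2 * (real p - 1)\<^sup>2 * B (singular_values A) / (real k)\<^sup>2 + C (singular_values A) / real k ^ 3"
        using variance_bound[OF assms] elim unfolding C B by simp
      also have "\<dots> \<le> 2 * tr (2 * p) * (real p)\<^sup>2 / real k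
          + (real p)\<^sup>2 * (real p - 1)\<^sup>2
            * (?s (2 * p) + 3 / 2 * ?s 2 * schatten_norm (4 * p - 4) A ^ (4 * p - 4) - 1 / 2 * (?s p)\<^sup>2) / (real k)\<^sup>2
          + C (singular_values A) / real k ^ 3"
        by (intro add_mono order_refl divide_right_mono second) simp
      finally show ?case unfolding norms tr(1) by (simp add: mult_ac)
    qed
  qed
qed

end
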